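(* Let $K$ be a commutative ring and let $\mathbf{V}$ be a variety of $K$-algebras cut out by a set of equations $\Omega$. Let $A$ be a $\mathbf{V}$-algebra. Then the universal enveloping algebra $U_{\mathbf{V}}(A)$ is, via the canonical map $\pi:\mathrm{Tens}_K(A\oplus A)\to U_{\mathbf{V}}(A)$, the quotient of $\mathrm{Tens}_K(A\oplus A)$ by the two-sided ideal $I$ generated by the set \[ \left\{\frac{\partial\omega}{\partial x}(a)\,:\,(S,\omega)\in\Omega,\ x\in S,\ a:S\to A \text{ a map of sets}\right\}. \]
   Context: $K$ is a commutative ring. A (magmatic) $K$-algebra is a $K$-module $A$ with a $K$-bilinear product, written as juxtaposition (no associativity, commutativity or unit assumed). For a set $S$, $Mag(S)$ is the free magma on $S$ (bracketed strings of elements of $S$), and $KMag(S)$, the free $K$-module on it with the induced bilinear product, is the free $K$-algebra on $S$. An equation is a pair $(S,\omega)$ with $S$ a finite set and $\omega\in KMag(S)$; a $K$-algebra $A$ satisfies it if for every set map $a:S\to A$ the induced algebra map $KMag(S)\to A$, written $\omega\mapsto\omega(a)$, sends $\omega$ to $0$. A variety $\mathbf{V}$ cut out by a set $\Omega$ of equations is the full subcategory of $K$-algebras satisfying all equations in $\Omega$; its objects are $\mathbf{V}$-algebras. Beck modules and universal enveloping algebras: a Beck $A$-module is an abelian group object in the slice category $\mathbf{V}/A$; equivalently, a $K$-module $M$ with $K$-linear maps $A\otimes_K M\to M$, $M\otimes_K A\to M$ (juxtaposition) such that $A\oplus M$ with product $(a,x)(b,y)=(ab,ay+xb)$ is a $\mathbf{V}$-algebra.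 Morphisms are $K$-linear maps commuting with both actions. The forgetful functor $u$ from Beck $A$-modules to $K$-modules has a left adjoint $F_A$, and $U_{\mathbf{V}}(A)=\mathrm{End}_A(F_AK)$, a unital associative $K$-algebra under composition. It acts on the right on $uM=\mathrm{Hom}_A(F_AK,M)$ by precomposition for each Beck $A$-module $M$. Let $\mathrm{Tens}_K(V)$ denote the tensor algebra on a $K$-module $V$, and let $\lambda,\rho:A\to\mathrm{Tens}_K(A\oplus A)$ be the inclusions of the first and second summands. For the variety of all $K$-algebras, the universal enveloping algebra is $\mathrm{Tens}_K(A\oplus A)$, acting on $M$ by $x\lambda(a)=ax$, $x\rho(a)=xa$. The canonical map $\pi:\mathrm{Tens}_K(A\oplus A)\to U_{\mathbf{V}}(A)$ is the unital $K$-algebra homomorphism such that $\pi(\lambda(a))$ and $\pi(\rho(a))$ act on every Beck $A$-module $M$ by $x\mapsto ax$ and $x\mapsto xa$ respectively. Noncommutative partial derivatives: for $x\in S$, $\frac{\partial}{\partial x}:KMag(S)\to\mathrm{Tens}_K(KMag(S)\oplus KMag(S))$ is the unique $K$-linear map with $\frac{\partial x}{\partial x}=1$, $\frac{\partial y}{\partial x}=0$ for $y\in S$, $y\neq x$, and \[ \frac{\partial(\alpha\beta)}{\partial x}=\frac{\partial\alpha}{\partial x}\rho_\beta+\frac{\partial\beta}{\partial x}\lambda_\alpha \] for $\alpha,\beta\in Mag(S)$, where $\lambda_\alpha,\rho_\alpha$ denote $\alpha$ in the first and second summand respectively. For a set map $a:S\to A$, applying the induced map $KMag(S)\to A$ on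 both summands gives a homomorphism of unital associative $K$-algebras $\mathrm{Tens}_K(KMag(S)\oplus KMag(S))\to\mathrm{Tens}_K(A\oplus A)$, denoted $\mu\mapsto\mu(a)$; $\frac{\partial\omega}{\partial x}(a)$ is the image of $\frac{\partial\omega}{\partial x}$. *)

theory Defs
  imports "HOL-Algebra.Module" "HOL-Algebra.QuotRing"
begin

text \<open>
  All algebraic structures are \<^typ>\<open>('k, 'a) module\<close> records. Algebras use the \<open>mult\<close> field
  as their product. Fields of a record that a notion does not mention (for example \<open>one\<close> in a
  magmatic algebra, \<open>mult\<close> and \<open>one\<close> in a plain module) carry no meaning.
\<close>

section \<open>Magmatic algebras and the free magmatic algebra\<close>

locale magmatic_algebra = module K A for K (structure) and A (structure) +
  assumes prod_closed:
      "\<lbrakk>x \<in> carrier A; y \<in> carrier A\<rbrakk> \<Longrightarrow> x \<otimes>\<^bsub>A\<^esub> y \<in> carrier A"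
    and prod_l_distr:
      "\<lbrakk>x \<in> carrier A; y \<in> carrier A; z \<in> carrier A\<rbrakk> \<Longrightarrow>
        (x \<oplus>\<^bsub>A\<^esub> y) \<otimes>\<^bsub>A\<^esub> z = x \<otimes>\<^bsub>A\<^esub> z \<oplus>\<^bsub>A\<^esub> y \<otimes>\<^bsub>A\<^esub> z"
    and prod_r_distr:
      "\<lbrakk>x \<in> carrier A; y \<in> carrier A; z \<in> carrier A\<rbrakk> \<Longrightarrow>
        x \<otimes>\<^bsub>A\<^esub> (y \<oplus>\<^bsub>A\<^esub> z) = x \<otimes>\<^bsub>A\<^esub> y \<oplus>\<^bsub>A\<^esub> x \<otimes>\<^bsub>A\<^esub> z"
    and prod_smult_l:
      "\<lbrakk>k \<in> carrier K; x \<in> carrier A; y \<in> carrier A\<rbrakk> \<Longrightarrow>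
        (k \<odot>\<^bsub>A\<^esub> x) \<otimes>\<^bsub>A\<^esub> y = k \<odot>\<^bsub>A\<^esub> (x \<otimes>\<^bsub>A\<^esub> y)"
    and prod_smult_r:
      "\<lbrakk>k \<in> carrier K; x \<in> carrier A; y \<in> carrier A\<rbrakk> \<Longrightarrow>
        x \<otimes>\<^bsub>A\<^esub> (k \<odot>\<^bsub>A\<^esub> y) = k \<odot>\<^bsub>A\<^esub> (x \<otimes>\<^bsub>A\<^esub> y)"

definition free_module :: "('k, 'r) ring_scheme \<Rightarrow> 'b set \<Rightarrow> ('k, 'b \<Rightarrow> 'k) module" where
  "free_module K B =
    \<lparr>carrier = {p. (\<forall>b. p b \<in> carrier K) \<and> finite {b. p b \<noteq> \<zero>\<^bsub>K\<^esub>} \<and> {b. p b \<noteq> \<zero>\<^bsub>K\<^esub>} \<subseteq> B},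
     mult = undefined, one = undefined,
     zero = (\<lambda>b. \<zero>\<^bsub>K\<^esub>), add = (\<lambda>p q b. p b \<oplus>\<^bsub>K\<^esub> q b),
     smult = (\<lambda>k p b. k \<otimes>\<^bsub>K\<^esub> p b)\<rparr>"

definition single :: "('k, 'r) ring_scheme \<Rightarrow> 'b \<Rightarrow> 'b \<Rightarrow> 'k" where
  "single K b = (\<lambda>c. if c = b then \<one>\<^bsub>K\<^esub> else \<zero>\<^bsub>K\<^esub>)"

text \<open>The \<open>K\<close>-linear extension of \<open>g\<close> from basis elements to the free module.\<close>

definition lin_ext ::
  "('k, 'r) ring_scheme \<Rightarrow> ('k, 'm, 's) module_scheme \<Rightarrow> ('b \<Rightarrow> 'm) \<Rightarrow> ('b \<Rightarrow> 'k) \<Rightarrow> 'm" where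
  "lin_ext K M g p = (\<Oplus>\<^bsub>M\<^esub>b\<in>{b. p b \<noteq> \<zero>\<^bsub>K\<^esub>}. p b \<odot>\<^bsub>M\<^esub> g b)"

datatype 'v mag = Gen 'v | Prod "'v mag" "'v mag"

definition Mag :: "'v set \<Rightarrow> 'v mag set" where
  "Mag S = {t. set_mag t \<subseteq> S}"

text \<open>In \<open>KMag\<close>, the coefficient of a product \<open>pq\<close> at a tree is determined by the unique
  decomposition of that tree; a generator is not a product.\<close>

definition KMag :: "('k, 'r) ring_scheme \<Rightarrow> 'v set \<Rightarrow> ('k, 'v mag \<Rightarrow> 'k) module" where
  "KMag K S = (free_module K (Mag S))
    \<lparr>mult := (\<lambda>p q t. case t of Gen x \<Rightarrow> \<zero>\<^bsub>K\<^esub> | Prod t1 t2 \<Rightarrow> p t1 \<otimes>\<^bsub>K\<^esub> q t2)\<rparr>"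

primrec mag_eval :: "('k, 'a, 's) module_scheme \<Rightarrow> ('v \<Rightarrow> 'a) \<Rightarrow> 'v mag \<Rightarrow> 'a" where
  "mag_eval A a (Gen x) = a x"
| "mag_eval A a (Prod s t) = mag_eval A a s \<otimes>\<^bsub>A\<^esub> mag_eval A a t"

definition eval_at ::
  "('k, 'r) ring_scheme \<Rightarrow> ('k, 'a, 's) module_scheme \<Rightarrow> ('v \<Rightarrow> 'a) \<Rightarrow> ('v mag \<Rightarrow> 'k) \<Rightarrow> 'a" where
  "eval_at K A a \<omega> = lin_ext K A (mag_eval A a) \<omega>"


section \<open>Equations and varieties\<close>

type_synonym ('v, 'k) equation = "'v set \<times> ('v mag \<Rightarrow> 'k)"

definition equations :: "('k, 'r) ring_scheme \<Rightarrow> ('v, 'k) equation set" where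
  "equations K = {(S, \<omega>). finite S \<and> \<omega> \<in> carrier (KMag K S)}"

definition satisfies ::
  "('k, 'r) ring_scheme \<Rightarrow> ('k, 'a, 's) module_scheme \<Rightarrow> ('v, 'k) equation \<Rightarrow> bool" where
  "satisfies K A = (\<lambda>(S, \<omega>). \<forall>a \<in> S \<rightarrow> carrier A. eval_at K A a \<omega> = \<zero>\<^bsub>A\<^esub>)"

definition in_variety ::
  "('k, 'r) ring_scheme \<Rightarrow> ('v, 'k) equation set \<Rightarrow> ('k, 'a, 's) module_scheme \<Rightarrow> bool" where
  "in_variety K \<Omega> A \<longleftrightarrow> magmatic_algebra K A \<and> (\<forall>E\<in>\<Omega>. satisfies K A E)"


section \<open>Beck modules\<close>

definition dsum ::
  "('k, 'a, 's) module_scheme \<Rightarrow> ('k, 'b, 't) module_scheme \<Rightarrow> ('k, 'a \<times> 'b) module" where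
  "dsum V W =
    \<lparr>carrier = carrier V \<times> carrier W, mult = undefined, one = undefined,
     zero = (\<zero>\<^bsub>V\<^esub>, \<zero>\<^bsub>W\<^esub>),
     add = (\<lambda>(v, w) (v', w'). (v \<oplus>\<^bsub>V\<^esub> v', w \<oplus>\<^bsub>W\<^esub> w')),
     smult = (\<lambda>k (v, w). (k \<odot>\<^bsub>V\<^esub> v, k \<odot>\<^bsub>W\<^esub> w))\<rparr>"

record ('k, 'a, 'm) bimod = "('k, 'm) module" +
  lact :: "'a \<Rightarrow> 'm \<Rightarrow> 'm"
  ract :: "'m \<Rightarrow> 'a \<Rightarrow> 'm"

definition square_zero_ext ::
  "('k, 'a, 's) module_scheme \<Rightarrow> ('k, 'a, 'm, 't) bimod_scheme \<Rightarrow> ('k, 'a \<times> 'm) module" where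
  "square_zero_ext A M = (dsum A M)
    \<lparr>mult := (\<lambda>(a, x) (b, y). (a \<otimes>\<^bsub>A\<^esub> b, lact M a y \<oplus>\<^bsub>M\<^esub> ract M x b))\<rparr>"

text \<open>\<open>K\<close>-linear maps out of \<open>A \<otimes> M\<close> and \<open>M \<otimes> A\<close> are given as \<open>K\<close>-bilinear maps.\<close>

locale beck_module = module K M
  for K (structure) and \<Omega> :: "('v, 'k) equation set"
    and A :: "('k, 'a) module" and M :: "('k, 'a, 'm) bimod" (structure) +
  assumes lact_closed:
      "\<lbrakk>a \<in> carrier A; x \<in> carrier M\<rbrakk> \<Longrightarrow> lact M a x \<in> carrier M"
    and lact_add_alg:
      "\<lbrakk>a \<in> carrier A; b \<in> carrier A; x \<in> carrier M\<rbrakk> \<Longrightarrow>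
        lact M (a \<oplus>\<^bsub>A\<^esub> b) x = lact M a x \<oplus>\<^bsub>M\<^esub> lact M b x"
    and lact_add:
      "\<lbrakk>a \<in> carrier A; x \<in> carrier M; y \<in> carrier M\<rbrakk> \<Longrightarrow>
        lact M a (x \<oplus>\<^bsub>M\<^esub> y) = lact M a x \<oplus>\<^bsub>M\<^esub> lact M a y"
    and lact_smult_alg:
      "\<lbrakk>k \<in> carrier K; a \<in> carrier A; x \<in> carrier M\<rbrakk> \<Longrightarrow>
        lact M (k \<odot>\<^bsub>A\<^esub> a) x = k \<odot>\<^bsub>M\<^esub> lact M a x"
    and lact_smult:
      "\<lbrakk>k \<in> carrier K; a \<in> carrier A; x \<in> carrier M\<rbrakk> \<Longrightarrow>
        lact M a (k \<odot>\<^bsub>M\<^esub> x) = k \<odot>\<^bsub>M\<^esub> lact M a x"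
    and ract_closed:
      "\<lbrakk>a \<in> carrier A; x \<in> carrier M\<rbrakk> \<Longrightarrow> ract M x a \<in> carrier M"
    and ract_add_alg:
      "\<lbrakk>a \<in> carrier A; b \<in> carrier A; x \<in> carrier M\<rbrakk> \<Longrightarrow>
        ract M x (a \<oplus>\<^bsub>A\<^esub> b) = ract M x a \<oplus>\<^bsub>M\<^esub> ract M x b"
    and ract_add:
      "\<lbrakk>a \<in> carrier A; x \<in> carrier M; y \<in> carrier M\<rbrakk> \<Longrightarrow>
        ract M (x \<oplus>\<^bsub>M\<^esub> y) a = ract M x a \<oplus>\<^bsub>M\<^esub> ract M y a"
    and ract_smult_alg:
      "\<lbrakk>k \<in> carrier K; a \<in> carrier A; x \<in> carrier M\<rbrakk> \<Longrightarrow>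
        ract M x (k \<odot>\<^bsub>A\<^esub> a) = k \<odot>\<^bsub>M\<^esub> ract M x a"
    and ract_smult:
      "\<lbrakk>k \<in> carrier K; a \<in> carrier A; x \<in> carrier M\<rbrakk> \<Longrightarrow>
        ract M (k \<odot>\<^bsub>M\<^esub> x) a = k \<odot>\<^bsub>M\<^esub> ract M x a"
    and square_zero_ext_in_variety: "in_variety K \<Omega> (square_zero_ext A M)"

text \<open>Morphisms are extensional functions, so that equality of morphisms is equality in HOL.\<close>

definition beck_hom ::
  "('k, 'r) ring_scheme \<Rightarrow> ('k, 'a) module \<Rightarrow> ('k, 'a, 'm) bimod \<Rightarrow> ('k, 'a, 'n) bimod
    \<Rightarrow> ('m \<Rightarrow> 'n) set" where
  "beck_hom K A M N = {f \<in> carrier M \<rightarrow>\<^sub>E carrier N.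
     (\<forall>x\<in>carrier M. \<forall>y\<in>carrier M. f (x \<oplus>\<^bsub>M\<^esub> y) = f x \<oplus>\<^bsub>N\<^esub> f y) \<and>
     (\<forall>k\<in>carrier K. \<forall>x\<in>carrier M. f (k \<odot>\<^bsub>M\<^esub> x) = k \<odot>\<^bsub>N\<^esub> f x) \<and>
     (\<forall>a\<in>carrier A. \<forall>x\<in>carrier M. f (lact M a x) = lact N a (f x)) \<and>
     (\<forall>a\<in>carrier A. \<forall>x\<in>carrier M. f (ract M x a) = ract N (f x) a)}"


section \<open>The universal enveloping algebra\<close>

text \<open>
  \<open>is_FAK TYPE('m) K \<Omega> A F e\<close> says that \<open>F\<close>, with universal element \<open>e\<close> (the image of \<open>1\<close> under
  the unit \<open>K \<rightarrow> u(F\<^sub>A K)\<close>), has the universal property of \<open>F\<^sub>A K\<close>, that is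
  \<open>Hom\<^sub>A(F, M) \<cong> Hom\<^sub>K(K, uM) = uM\<close> via evaluation at \<open>e\<close>. A HOL formula cannot quantify over
  types, so the property is relative to the Beck modules \<open>M\<close> carried by a given type \<open>'m\<close>.
  The value at \<open>K\<close> of a left adjoint of \<open>u\<close> satisfies it for every type \<open>'m\<close>; assuming it for
  particular types only, such as the type of the quotients \<open>Tens2 K A Quot J\<close> below, is a weaker
  hypothesis on \<open>F\<close>.
\<close>

definition is_FAK ::
  "'m itself \<Rightarrow> ('k, 'r) ring_scheme \<Rightarrow> ('v, 'k) equation set \<Rightarrow> ('k, 'a) module
    \<Rightarrow> ('k, 'a, 'f) bimod \<Rightarrow> 'f \<Rightarrow> bool" where
  "is_FAK _ K \<Omega> A F e \<longleftrightarrow>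
     beck_module K \<Omega> A F \<and> e \<in> carrier F \<and>
     (\<forall>M :: ('k, 'a, 'm) bimod. beck_module K \<Omega> A M \<longrightarrow>
        (\<forall>x\<in>carrier M. \<exists>!f. f \<in> beck_hom K A F M \<and> f e = x))"

definition beck_End ::
  "('k, 'r) ring_scheme \<Rightarrow> ('k, 'a) module \<Rightarrow> ('k, 'a, 'm) bimod \<Rightarrow> ('k, 'm \<Rightarrow> 'm) module" where
  "beck_End K A M =
    \<lparr>carrier = beck_hom K A M M,
     mult = (\<lambda>f g. compose (carrier M) f g),
     one = (\<lambda>x\<in>carrier M. x),
     zero = (\<lambda>x\<in>carrier M. \<zero>\<^bsub>M\<^esub>),
     add = (\<lambda>f g. \<lambda>x\<in>carrier M. f x \<oplus>\<^bsub>M\<^esub> g x),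
     smult = (\<lambda>k f. \<lambda>x\<in>carrier M. k \<odot>\<^bsub>M\<^esub> f x)\<rparr>"

text \<open>The right action of \<open>End\<^sub>A(F\<^sub>A K)\<close> on \<open>uM = Hom\<^sub>A(F\<^sub>A K, M)\<close> by precomposition:
  \<open>x\<close> corresponds to the morphism sending \<open>e\<close> to \<open>x\<close>.\<close>

definition env_act ::
  "('k, 'r) ring_scheme \<Rightarrow> ('k, 'a) module \<Rightarrow> ('k, 'a, 'f) bimod \<Rightarrow> 'f
    \<Rightarrow> ('k, 'a, 'm) bimod \<Rightarrow> 'm \<Rightarrow> ('f \<Rightarrow> 'f) \<Rightarrow> 'm" where
  "env_act K A F e M x \<phi> =
     compose (carrier F) (THE f. f \<in> beck_hom K A F M \<and> f e = x) \<phi> e"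


section \<open>Tensor algebras\<close>

text \<open>
  The tensor algebra of \<open>V\<close> is the free associative unital \<open>K\<close>-algebra on the set \<open>carrier V\<close>
  modulo the two-sided ideal forcing the inclusion of generators to be \<open>K\<close>-linear.
  Elements of the free algebra are finitely supported functions on words.
\<close>

definition word_alg :: "('k, 'r) ring_scheme \<Rightarrow> 'b set \<Rightarrow> ('k, 'b list \<Rightarrow> 'k) module" where
  "word_alg K B = (free_module K (lists B))
    \<lparr>mult := (\<lambda>p q w. \<Oplus>\<^bsub>K\<^esub>i\<in>{..length w}. p (take i w) \<otimes>\<^bsub>K\<^esub> q (drop i w)),
     one := single K []\<rparr>"

definition tens_rels ::
  "('k, 'r) ring_scheme \<Rightarrow> ('k, 'b, 's) module_scheme \<Rightarrow> ('b list \<Rightarrow> 'k) set" where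
  "tens_rels K V = (let W = word_alg K (carrier V) in
     {single K [v \<oplus>\<^bsub>V\<^esub> w] \<ominus>\<^bsub>W\<^esub> (single K [v] \<oplus>\<^bsub>W\<^esub> single K [w]) | v w.
        v \<in> carrier V \<and> w \<in> carrier V} \<union>
     {single K [k \<odot>\<^bsub>V\<^esub> v] \<ominus>\<^bsub>W\<^esub> k \<odot>\<^bsub>W\<^esub> single K [v] | k v.
        k \<in> carrier K \<and> v \<in> carrier V})"

definition tens_ideal ::
  "('k, 'r) ring_scheme \<Rightarrow> ('k, 'b, 's) module_scheme \<Rightarrow> ('b list \<Rightarrow> 'k) set" where
  "tens_ideal K V = genideal (word_alg K (carrier V)) (tens_rels K V)"

definition Tens ::
  "('k, 'r) ring_scheme \<Rightarrow> ('k, 'b, 's) module_scheme \<Rightarrow> ('k, ('b list \<Rightarrow> 'k) set) module" where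
  "Tens K V = (let W = word_alg K (carrier V); J = tens_ideal K V; Q = W Quot J in
    \<lparr>carrier = carrier Q, mult = mult Q, one = one Q, zero = zero Q, add = add Q,
     smult = (\<lambda>k X. \<Union>p\<in>X. J +>\<^bsub>W\<^esub> (k \<odot>\<^bsub>W\<^esub> p))\<rparr>)"

definition tens_incl ::
  "('k, 'r) ring_scheme \<Rightarrow> ('k, 'b, 's) module_scheme \<Rightarrow> 'b \<Rightarrow> ('b list \<Rightarrow> 'k) set" where
  "tens_incl K V v = tens_ideal K V +>\<^bsub>word_alg K (carrier V)\<^esub> single K [v]"

text \<open>For a \<open>K\<close>-linear map \<open>f\<close> from \<open>V\<close> to an associative unital algebra \<open>B\<close>, \<open>tens_lift K B f\<close> is
  the induced algebra homomorphism on \<open>Tens K V\<close>, evaluated on a coset through its members.\<close>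

definition tens_lift ::
  "('k, 'r) ring_scheme \<Rightarrow> ('k, 'c, 's) module_scheme \<Rightarrow> ('b \<Rightarrow> 'c) \<Rightarrow> ('b list \<Rightarrow> 'k) set \<Rightarrow> 'c" where
  "tens_lift K B f X =
     the_elem (lin_ext K B (\<lambda>w. foldr (\<lambda>v r. f v \<otimes>\<^bsub>B\<^esub> r) w \<one>\<^bsub>B\<^esub>) ` X)"

abbreviation Tens2 ::
  "('k, 'r) ring_scheme \<Rightarrow> ('k, 'a, 's) module_scheme
    \<Rightarrow> ('k, (('a \<times> 'a) list \<Rightarrow> 'k) set) module" where
  "Tens2 K A \<equiv> Tens K (dsum A A)"

definition tens_lambda ::
  "('k, 'r) ring_scheme \<Rightarrow> ('k, 'a, 's) module_scheme \<Rightarrow> 'a \<Rightarrow> (('a \<times> 'a) list \<Rightarrow> 'k) set" where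
  "tens_lambda K A a = tens_incl K (dsum A A) (a, \<zero>\<^bsub>A\<^esub>)"

definition tens_rho ::
  "('k, 'r) ring_scheme \<Rightarrow> ('k, 'a, 's) module_scheme \<Rightarrow> 'a \<Rightarrow> (('a \<times> 'a) list \<Rightarrow> 'k) set" where
  "tens_rho K A a = tens_incl K (dsum A A) (\<zero>\<^bsub>A\<^esub>, a)"


section \<open>Noncommutative partial derivatives\<close>

primrec mag_deriv ::
  "('k, 'r) ring_scheme \<Rightarrow> 'v set \<Rightarrow> 'v \<Rightarrow> 'v mag
    \<Rightarrow> ((('v mag \<Rightarrow> 'k) \<times> ('v mag \<Rightarrow> 'k)) list \<Rightarrow> 'k) set" where
  "mag_deriv K S x (Gen y) =
     (if y = x then \<one>\<^bsub>Tens2 K (KMag K S)\<^esub> else \<zero>\<^bsub>Tens2 K (KMag K S)\<^esub>)"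
| "mag_deriv K S x (Prod \<alpha> \<beta>) =
     mag_deriv K S x \<alpha> \<otimes>\<^bsub>Tens2 K (KMag K S)\<^esub> tens_rho K (KMag K S) (single K \<beta>)
     \<oplus>\<^bsub>Tens2 K (KMag K S)\<^esub>
     mag_deriv K S x \<beta> \<otimes>\<^bsub>Tens2 K (KMag K S)\<^esub> tens_lambda K (KMag K S) (single K \<alpha>)"

definition partial_deriv ::
  "('k, 'r) ring_scheme \<Rightarrow> 'v set \<Rightarrow> 'v \<Rightarrow> ('v mag \<Rightarrow> 'k)
    \<Rightarrow> ((('v mag \<Rightarrow> 'k) \<times> ('v mag \<Rightarrow> 'k)) list \<Rightarrow> 'k) set" where
  "partial_deriv K S x \<omega> = lin_ext K (Tens2 K (KMag K S)) (mag_deriv K S x) \<omega>"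

text \<open>The map \<open>\<mu> \<mapsto> \<mu>(a)\<close>.\<close>

definition tens_eval ::
  "('k, 'r) ring_scheme \<Rightarrow> ('k, 'a, 's) module_scheme \<Rightarrow> ('v \<Rightarrow> 'a)
    \<Rightarrow> ((('v mag \<Rightarrow> 'k) \<times> ('v mag \<Rightarrow> 'k)) list \<Rightarrow> 'k) set \<Rightarrow> (('a \<times> 'a) list \<Rightarrow> 'k) set" where
  "tens_eval K A a \<mu> =
     tens_lift K (Tens2 K A)
       (\<lambda>(\<alpha>, \<beta>). tens_incl K (dsum A A) (eval_at K A a \<alpha>, eval_at K A a \<beta>)) \<mu>"

definition deriv_ideal ::
  "('k, 'r) ring_scheme \<Rightarrow> ('v, 'k) equation set \<Rightarrow> ('k, 'a, 's) module_scheme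
    \<Rightarrow> (('a \<times> 'a) list \<Rightarrow> 'k) set set" where
  "deriv_ideal K \<Omega> A = genideal (Tens2 K A)
     {tens_eval K A a (partial_deriv K S x \<omega>) | S \<omega> x a.
        (S, \<omega>) \<in> \<Omega> \<and> x \<in> S \<and> a \<in> S \<rightarrow> carrier A}"


section \<open>The canonical map\<close>

definition unital_alg_hom ::
  "('k, 'r) ring_scheme \<Rightarrow> ('k, 'b, 's) module_scheme \<Rightarrow> ('k, 'c, 't) module_scheme
    \<Rightarrow> ('b \<Rightarrow> 'c) set" where
  "unital_alg_hom K B C = {h \<in> ring_hom B C.
     \<forall>k\<in>carrier K. \<forall>x\<in>carrier B. h (k \<odot>\<^bsub>B\<^esub> x) = k \<odot>\<^bsub>C\<^esub> h x}"

definition is_canonical_map ::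
  "'m itself \<Rightarrow> ('k, 'r) ring_scheme \<Rightarrow> ('v, 'k) equation set \<Rightarrow> ('k, 'a) module
    \<Rightarrow> ('k, 'a, 'f) bimod \<Rightarrow> 'f \<Rightarrow> ((('a \<times> 'a) list \<Rightarrow> 'k) set \<Rightarrow> 'f \<Rightarrow> 'f) \<Rightarrow> bool" where
  "is_canonical_map _ K \<Omega> A F e \<pi> \<longleftrightarrow>
     \<pi> \<in> extensional (carrier (Tens2 K A)) \<and>
     \<pi> \<in> unital_alg_hom K (Tens2 K A) (beck_End K A F) \<and>
     (\<forall>M :: ('k, 'a, 'm) bimod. beck_module K \<Omega> A M \<longrightarrow>
       (\<forall>x\<in>carrier M. \<forall>a\<in>carrier A.
          env_act K A F e M x (\<pi> (tens_lambda K A a)) = lact M a x \<and>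
          env_act K A F e M x (\<pi> (tens_rho K A a)) = ract M x a))"

end

theory Submission
  imports Defs
begin

text \<open>
  Write \<open>T = Tens2 K A\<close>, let \<open>I\<close> be the ideal generated by the evaluated partial derivatives of the
  equations, and let \<open>F\<close> be the free Beck module with generator \<open>e\<close>. An endomorphism of \<open>F\<close> is
  determined by its value at \<open>e\<close>, which may be any element of \<open>F\<close>. The universal property of the
  tensor algebra therefore provides exactly one algebra map \<open>\<pi>\<close> from \<open>T\<close> to the endomorphisms of \<open>F\<close>
  for which \<open>\<pi> (\<lambda> a)\<close> sends \<open>e\<close> to \<open>a e\<close> and \<open>\<pi> (\<rho> a)\<close> sends \<open>e\<close> to \<open>e a\<close>; this is the canonical map.

  The main computation is a chain rule (\<open>eval_square_zero_ext\<close>): evaluating \<open>\<omega>\<close> in the square-zero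
  extension \<open>A \<oplus> M\<close> at a point \<open>(a, m)\<close> gives \<open>\<omega>(a)\<close> in the first component, and in the second the
  sum over the variables \<open>x\<close> of \<open>m\<^sub>x\<close> acted on by the derivative of \<open>\<omega>\<close> with respect to \<open>x\<close> at \<open>a\<close>.
  It is used twice. Applied to \<open>F\<close>, it shows that the derivatives act as zero on \<open>e\<close>, so that \<open>I\<close> is
  contained in the kernel of \<open>\<pi>\<close> (\<open>derivative_in_kernel\<close>). Applied to \<open>T/I\<close>, on which \<open>A\<close> acts by right
  multiplication, it shows that \<open>T/I\<close> is a Beck module (\<open>quot_bimod_beck_module\<close>).

  Hence there is a morphism \<open>g\<close> from \<open>F\<close> to \<open>T/I\<close> with \<open>g e = 1\<close>. It satisfies \<open>g (\<pi> t e) = t + I\<close>,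
  since both sides are morphisms out of \<open>T\<close> that agree at \<open>1\<close>; so the kernel of \<open>\<pi>\<close> is contained in \<open>I\<close>.
  The composite of \<open>g\<close> with the map \<open>t + I \<mapsto> \<pi> t e\<close> is an endomorphism of \<open>F\<close> that fixes \<open>e\<close>, hence the
  identity. So every element of \<open>F\<close> has the form \<open>\<pi> t e\<close>, and \<open>\<pi>\<close> is surjective.
\<close>

section \<open>Linear maps and free modules\<close>

lemma abelian_group_cong:
  assumes "abelian_group M"
    and "carrier N = carrier M" "zero N = zero M" "add N = add M"
  shows "abelian_group N"
proof -
  interpret M: abelian_group M by fact
  show ?thesis
    using abelian_groupE[OF assms(1)] by (intro abelian_groupI) (simp_all add: assms(2-))
qed

lemma module_cong:
  assumes "module K M"
    and "carrier N = carrier M" "zero N = zero M" "add N = add M" "smult N = smult M"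
  shows "module K N"
proof -
  interpret M: module K M by fact
  show ?thesis
  proof (rule moduleI)
    show "abelian_group N"
      by (rule abelian_group_cong[OF M.abelian_group_axioms assms(2-4)])
  qed (auto simp: assms(2-) M.R.cring_axioms M.smult_l_distr M.smult_r_distr M.smult_assoc1)
qed

text \<open>The \<open>K\<close>-linear maps from \<open>V\<close> to \<open>W\<close>. Values outside the carrier of \<open>V\<close> are arbitrary, so
  equality of linear maps is stated pointwise on the carrier.\<close>

definition lin_hom ::
  "('k, 'r) ring_scheme \<Rightarrow> ('k, 'b, 's) module_scheme \<Rightarrow> ('k, 'c, 't) module_scheme \<Rightarrow> ('b \<Rightarrow> 'c) set" where
  "lin_hom K V W = {f \<in> carrier V \<rightarrow> carrier W.
     (\<forall>x\<in>carrier V. \<forall>y\<in>carrier V. f (x \<oplus>\<^bsub>V\<^esub> y) = f x \<oplus>\<^bsub>W\<^esub> f y) \<and>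
     (\<forall>k\<in>carrier K. \<forall>x\<in>carrier V. f (k \<odot>\<^bsub>V\<^esub> x) = k \<odot>\<^bsub>W\<^esub> f x)}"

lemma lin_homI:
  assumes "\<And>x. x \<in> carrier V \<Longrightarrow> f x \<in> carrier W"
    and "\<And>x y. x \<in> carrier V \<Longrightarrow> y \<in> carrier V \<Longrightarrow> f (x \<oplus>\<^bsub>V\<^esub> y) = f x \<oplus>\<^bsub>W\<^esub> f y"
    and "\<And>k x. k \<in> carrier K \<Longrightarrow> x \<in> carrier V \<Longrightarrow> f (k \<odot>\<^bsub>V\<^esub> x) = k \<odot>\<^bsub>W\<^esub> f x"
  shows "f \<in> lin_hom K V W"
  using assms by (auto simp: lin_hom_def)

lemma lin_homD:
  assumes "f \<in> lin_hom K V W"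
  shows "x \<in> carrier V \<Longrightarrow> f x \<in> carrier W"
    and "x \<in> carrier V \<Longrightarrow> y \<in> carrier V \<Longrightarrow> f (x \<oplus>\<^bsub>V\<^esub> y) = f x \<oplus>\<^bsub>W\<^esub> f y"
    and "k \<in> carrier K \<Longrightarrow> x \<in> carrier V \<Longrightarrow> f (k \<odot>\<^bsub>V\<^esub> x) = k \<odot>\<^bsub>W\<^esub> f x"
  using assms by (auto simp: lin_hom_def)

lemma lin_hom_comp:
  assumes "f \<in> lin_hom K V W" "g \<in> lin_hom K W X"
  shows "(\<lambda>x. g (f x)) \<in> lin_hom K V X"
  by (rule lin_homI) (simp_all add: lin_homD[OF assms(1)] lin_homD[OF assms(2)])

lemma lin_hom_zero:
  assumes "f \<in> lin_hom K V W" "module K V" "module K W"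
  shows "f \<zero>\<^bsub>V\<^esub> = \<zero>\<^bsub>W\<^esub>"
proof -
  interpret V: module K V by fact
  interpret W: module K W by fact
  have "f (\<zero>\<^bsub>K\<^esub> \<odot>\<^bsub>V\<^esub> \<zero>\<^bsub>V\<^esub>) = \<zero>\<^bsub>K\<^esub> \<odot>\<^bsub>W\<^esub> f \<zero>\<^bsub>V\<^esub>"
    by (intro lin_homD(3)[OF assms(1)]) auto
  then show ?thesis
    using lin_homD(1)[OF assms(1)] by simp
qed

lemma lin_hom_finsum:
  assumes f: "f \<in> lin_hom K V W" and V: "module K V" and W: "module K W"
    and fin: "finite I" and g: "\<And>i. i \<in> I \<Longrightarrow> g i \<in> carrier V"
  shows "f (\<Oplus>\<^bsub>V\<^esub>i\<in>I. g i) = (\<Oplus>\<^bsub>W\<^esub>i\<in>I. f (g i))"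
proof -
  interpret V: module K V by fact
  interpret W: module K W by fact
  show ?thesis using fin g
  proof (induction I rule: finite_induct)
    case empty
    then show ?case using lin_hom_zero[OF f V W] by simp
  next
    case (insert i I)
    have g': "g \<in> I \<rightarrow> carrier V" "g i \<in> carrier V"
      using insert.prems by auto
    then have "(\<lambda>i. f (g i)) \<in> I \<rightarrow> carrier W" "f (g i) \<in> carrier W"
      using lin_homD(1)[OF f] by auto
    then show ?case
      using insert g' by (simp add: V.finsum_insert W.finsum_insert lin_homD(2)[OF f])
  qed
qed

lemma lin_hom_pointwise_finsum:
  assumes "finite I" and W: "module K W"
    and f: "\<And>i. i \<in> I \<Longrightarrow> f i \<in> lin_hom K V W"
  shows "(\<lambda>x. \<Oplus>\<^bsub>W\<^esub>i\<in>I. f i x) \<in> lin_hom K V W"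
proof -
  interpret W: module K W by fact
  have c: "(\<lambda>i. f i x) \<in> I \<rightarrow> carrier W" if "x \<in> carrier V" for x
    using lin_homD(1)[OF f] that by auto
  show ?thesis
  proof (rule lin_homI)
    fix x y assume "x \<in> carrier V" "y \<in> carrier V"
    then show "(\<Oplus>\<^bsub>W\<^esub>i\<in>I. f i (x \<oplus>\<^bsub>V\<^esub> y)) = (\<Oplus>\<^bsub>W\<^esub>i\<in>I. f i x) \<oplus>\<^bsub>W\<^esub> (\<Oplus>\<^bsub>W\<^esub>i\<in>I. f i y)"
      using c W.finsum_addf[of "\<lambda>i. f i x" I "\<lambda>i. f i y"]
      by (simp add: lin_homD(2)[OF f] Pi_iff cong: W.finsum_cong)
  next
    fix k x assume "k \<in> carrier K" "x \<in> carrier V"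
    then show "(\<Oplus>\<^bsub>W\<^esub>i\<in>I. f i (k \<odot>\<^bsub>V\<^esub> x)) = k \<odot>\<^bsub>W\<^esub> (\<Oplus>\<^bsub>W\<^esub>i\<in>I. f i x)"
      using c W.finsum_smult_ldistr[OF \<open>finite I\<close>, of k "\<lambda>i. f i x"]
      by (simp add: lin_homD(3)[OF f] Pi_iff cong: W.finsum_cong)
  qed (use c in auto)
qed

lemma free_module_carrierD:
  assumes "p \<in> carrier (free_module K B)"
  shows "p b \<in> carrier K" "finite {b. p b \<noteq> \<zero>\<^bsub>K\<^esub>}" "p b \<noteq> \<zero>\<^bsub>K\<^esub> \<Longrightarrow> b \<in> B"
  using assms by (auto simp: free_module_def)

lemma free_module_carrierI:
  assumes "\<And>b. p b \<in> carrier K" and "finite C" "C \<subseteq> B" and "\<And>b. b \<notin> C \<Longrightarrow> p b = \<zero>\<^bsub>K\<^esub>"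
  shows "p \<in> carrier (free_module K B)"
proof -
  have "{b. p b \<noteq> \<zero>\<^bsub>K\<^esub>} \<subseteq> C"
    using assms(4) by auto
  then show ?thesis
    using assms(1-3) by (auto simp: free_module_def intro: finite_subset)
qed

lemma free_module_sel [simp]:
  "\<zero>\<^bsub>free_module K B\<^esub> = (\<lambda>b. \<zero>\<^bsub>K\<^esub>)"
  "p \<oplus>\<^bsub>free_module K B\<^esub> q = (\<lambda>b. p b \<oplus>\<^bsub>K\<^esub> q b)"
  "k \<odot>\<^bsub>free_module K B\<^esub> p = (\<lambda>b. k \<otimes>\<^bsub>K\<^esub> p b)"
  by (simp_all add: free_module_def)

lemma free_module_closed:
  assumes "cring K"
  shows "(\<lambda>b. \<zero>\<^bsub>K\<^esub>) \<in> carrier (free_module K B)"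
    and "p \<in> carrier (free_module K B) \<Longrightarrow> q \<in> carrier (free_module K B) \<Longrightarrow>
      (\<lambda>b. p b \<oplus>\<^bsub>K\<^esub> q b) \<in> carrier (free_module K B)"
    and "k \<in> carrier K \<Longrightarrow> p \<in> carrier (free_module K B) \<Longrightarrow>
      (\<lambda>b. k \<otimes>\<^bsub>K\<^esub> p b) \<in> carrier (free_module K B)"
    and "b \<in> B \<Longrightarrow> single K b \<in> carrier (free_module K B)"
proof -
  interpret cring K by fact
  show "(\<lambda>b. \<zero>\<^bsub>K\<^esub>) \<in> carrier (free_module K B)"
    by (rule free_module_carrierI[of _ _ "{}"]) auto
  show "(\<lambda>b. p b \<oplus>\<^bsub>K\<^esub> q b) \<in> carrier (free_module K B)"
    if p: "p \<in> carrier (free_module K B)" and q: "q \<in> carrier (free_module K B)"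
    by (rule free_module_carrierI[of _ _ "{b. p b \<noteq> \<zero>\<^bsub>K\<^esub>} \<union> {b. q b \<noteq> \<zero>\<^bsub>K\<^esub>}"])
      (use free_module_carrierD[OF p] free_module_carrierD[OF q] in auto)
  show "(\<lambda>b. k \<otimes>\<^bsub>K\<^esub> p b) \<in> carrier (free_module K B)"
    if "k \<in> carrier K" and p: "p \<in> carrier (free_module K B)"
    by (rule free_module_carrierI[of _ _ "{b. p b \<noteq> \<zero>\<^bsub>K\<^esub>}"])
      (use that free_module_carrierD[OF p] in auto)
  show "single K b \<in> carrier (free_module K B)" if "b \<in> B"
    by (rule free_module_carrierI[of _ _ "{b}"]) (use that in \<open>auto simp: single_def\<close>)
qed

lemma free_module_module:
  assumes "cring K"
  shows "module K (free_module K B)"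
proof -
  interpret cring K by fact
  note D = free_module_carrierD and C = free_module_closed[OF assms]
  show ?thesis
  proof (rule moduleI)
    show "abelian_group (free_module K B)"
    proof (rule abelian_groupI)
      fix p assume p: "p \<in> carrier (free_module K B)"
      show "\<exists>q\<in>carrier (free_module K B). q \<oplus>\<^bsub>free_module K B\<^esub> p = \<zero>\<^bsub>free_module K B\<^esub>"
        by (rule bexI[of _ "\<lambda>b. (\<ominus>\<^bsub>K\<^esub> \<one>\<^bsub>K\<^esub>) \<otimes>\<^bsub>K\<^esub> p b"])
          (use D(1)[OF p] C(3)[of "\<ominus>\<^bsub>K\<^esub> \<one>\<^bsub>K\<^esub>", OF _ p] in \<open>simp_all add: l_minus l_neg\<close>)
    qed (simp_all add: C D(1) a_assoc, simp add: D(1) a_comm)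
  qed (simp_all add: assms C D(1) l_distr r_distr m_assoc)
qed

text \<open>The single step only mentions multiples of basis elements, so that closure under scalars need
  not be proved separately.\<close>

lemma free_module_induct [consumes 2, case_names zero add single]:
  assumes "cring K" and p: "p \<in> carrier (free_module K B)"
    and zero: "P (\<lambda>b. \<zero>\<^bsub>K\<^esub>)"
    and add: "\<And>p q. p \<in> carrier (free_module K B) \<Longrightarrow> q \<in> carrier (free_module K B) \<Longrightarrow>
      P p \<Longrightarrow> P q \<Longrightarrow> P (\<lambda>b. p b \<oplus>\<^bsub>K\<^esub> q b)"
    and single: "\<And>k b. k \<in> carrier K \<Longrightarrow> b \<in> B \<Longrightarrow> P (\<lambda>c. k \<otimes>\<^bsub>K\<^esub> single K b c)"
  shows "P p"
proof -
  interpret cring K by fact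
  have "P p" if "finite C" "p \<in> carrier (free_module K B)" "{b. p b \<noteq> \<zero>\<^bsub>K\<^esub>} \<subseteq> C" for C p
    using that
  proof (induction C arbitrary: p rule: finite_induct)
    case empty
    then have "p = (\<lambda>b. \<zero>\<^bsub>K\<^esub>)" by auto
    then show ?case using zero by simp
  next
    case (insert c C)
    note pD = free_module_carrierD[OF insert.prems(1)]
    show ?case
    proof (cases "p c = \<zero>\<^bsub>K\<^esub>")
      case True
      then show ?thesis using insert by auto
    next
      case False
      define q where "q = p(c := \<zero>\<^bsub>K\<^esub>)"
      have q: "q \<in> carrier (free_module K B)"
        by (rule free_module_carrierI[of _ _ "{b. p b \<noteq> \<zero>\<^bsub>K\<^esub>}"]) (use pD in \<open>auto simp: q_def\<close>)
      have "P q"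
        by (rule insert.IH[OF q]) (use insert.prems(2) in \<open>auto simp: q_def\<close>)
      moreover have "P (\<lambda>d. p c \<otimes>\<^bsub>K\<^esub> single K c d)"
        using False pD by (intro single) auto
      moreover have "(\<lambda>d. p c \<otimes>\<^bsub>K\<^esub> single K c d) \<in> carrier (free_module K B)"
        using False pD by (intro free_module_closed[OF assms(1)]) auto
      ultimately have "P (\<lambda>d. q d \<oplus>\<^bsub>K\<^esub> p c \<otimes>\<^bsub>K\<^esub> single K c d)"
        using q by (intro add) auto
      also have "(\<lambda>d. q d \<oplus>\<^bsub>K\<^esub> p c \<otimes>\<^bsub>K\<^esub> single K c d) = p"
        using pD(1) by (auto simp: fun_eq_iff q_def single_def)
      finally show ?thesis .
    qed
  qed
  from this[OF free_module_carrierD(2)[OF p] p] show ?thesis by simp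
qed

text \<open>Linear maps on a free module are determined by the basis. The source \<open>V\<close> is only required
  to have the module structure of the free module, so that the statement applies to \<open>KMag\<close> and to
  the word algebra, which carry a product in addition.\<close>

lemma free_module_lin_eqI:
  assumes "cring K" and V: "carrier V = carrier (free_module K B)"
      "add V = add (free_module K B)" "smult V = smult (free_module K B)"
      "zero V = zero (free_module K B)"
    and W: "module K W" and f: "f \<in> lin_hom K V W" and g: "g \<in> lin_hom K V W"
    and eq: "\<And>b. b \<in> B \<Longrightarrow> f (single K b) = g (single K b)"
    and p: "p \<in> carrier V"
  shows "f p = g p"
proof -
  interpret W: module K W by fact
  have mV: "module K V"
    by (rule module_cong[OF free_module_module[OF assms(1)]]) (use V in auto)
  have z: "f (\<lambda>b. \<zero>\<^bsub>K\<^esub>) = \<zero>\<^bsub>W\<^esub>" "g (\<lambda>b. \<zero>\<^bsub>K\<^esub>) = \<zero>\<^bsub>W\<^esub>"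
    using lin_hom_zero[OF f mV W] lin_hom_zero[OF g mV W] by (simp_all add: V)
  note fD = lin_homD[OF f, unfolded V free_module_sel]
    and gD = lin_homD[OF g, unfolded V free_module_sel]
  from assms(1) p[unfolded V] show ?thesis
    by (induction rule: free_module_induct)
      (simp_all add: z fD gD eq free_module_closed[OF assms(1)])
qed

lemma lin_ext_superset:
  assumes M: "module K M" and "p \<in> carrier (free_module K B)" "g \<in> B \<rightarrow> carrier M"
    and "finite C" "{b. p b \<noteq> \<zero>\<^bsub>K\<^esub>} \<subseteq> C" "C \<subseteq> B"
  shows "lin_ext K M g p = (\<Oplus>\<^bsub>M\<^esub>b\<in>C. p b \<odot>\<^bsub>M\<^esub> g b)"
proof -
  interpret M: module K M by fact
  note pD = free_module_carrierD[OF assms(2)]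
  have "g b \<in> carrier M" if "b \<in> C" for b
    using assms(3,6) that by auto
  then show ?thesis unfolding lin_ext_def
    by (intro M.add.finprod_mono_neutral_cong_left) (use assms(4,5) pD(1) in auto)
qed

lemma lin_ext_lin_hom:
  assumes "cring K" and M: "module K M" and g: "g \<in> B \<rightarrow> carrier M"
  shows "lin_ext K M g \<in> lin_hom K (free_module K B) M"
proof -
  interpret M: module K M by fact
  let ?s = "\<lambda>p. {b. p b \<noteq> \<zero>\<^bsub>K\<^esub>}"
  note D = free_module_carrierD and C = free_module_closed[OF assms(1)]
  have Pi: "(\<lambda>b. p b \<odot>\<^bsub>M\<^esub> g b) \<in> C \<rightarrow> carrier M"
    if "p \<in> carrier (free_module K B)" "C \<subseteq> B" for p C
    using D(1)[OF that(1)] that(2) g by auto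
  show ?thesis
  proof (rule lin_homI)
    fix p assume p: "p \<in> carrier (free_module K B)"
    show "lin_ext K M g p \<in> carrier M"
      unfolding lin_ext_def using Pi[OF p, of "?s p"] D(3)[OF p] by (auto intro!: M.finsum_closed)
  next
    fix p q assume p: "p \<in> carrier (free_module K B)" and q: "q \<in> carrier (free_module K B)"
    let ?C = "?s p \<union> ?s q"
    have CB: "?C \<subseteq> B" "finite ?C" using D[OF p] D[OF q] by auto
    have "lin_ext K M g (\<lambda>b. p b \<oplus>\<^bsub>K\<^esub> q b) = (\<Oplus>\<^bsub>M\<^esub>b\<in>?C. (p b \<oplus>\<^bsub>K\<^esub> q b) \<odot>\<^bsub>M\<^esub> g b)"
      by (rule lin_ext_superset[OF M C(2)[OF p q] g]) (use CB in auto)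
    also have "\<dots> = (\<Oplus>\<^bsub>M\<^esub>b\<in>?C. p b \<odot>\<^bsub>M\<^esub> g b \<oplus>\<^bsub>M\<^esub> q b \<odot>\<^bsub>M\<^esub> g b)"
      using Pi[OF p CB(1)] Pi[OF q CB(1)] CB(1) g
      by (intro M.finsum_cong') (auto intro!: M.smult_l_distr simp: D(1)[OF p] D(1)[OF q])
    also have "\<dots> = (\<Oplus>\<^bsub>M\<^esub>b\<in>?C. p b \<odot>\<^bsub>M\<^esub> g b) \<oplus>\<^bsub>M\<^esub> (\<Oplus>\<^bsub>M\<^esub>b\<in>?C. q b \<odot>\<^bsub>M\<^esub> g b)"
      by (rule M.finsum_addf[OF Pi[OF p CB(1)] Pi[OF q CB(1)]])
    also have "(\<Oplus>\<^bsub>M\<^esub>b\<in>?C. p b \<odot>\<^bsub>M\<^esub> g b) = lin_ext K M g p"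
      by (rule lin_ext_superset[OF M p g, symmetric]) (use CB in auto)
    also have "(\<Oplus>\<^bsub>M\<^esub>b\<in>?C. q b \<odot>\<^bsub>M\<^esub> g b) = lin_ext K M g q"
      by (rule lin_ext_superset[OF M q g, symmetric]) (use CB in auto)
    finally show "lin_ext K M g (p \<oplus>\<^bsub>free_module K B\<^esub> q) = lin_ext K M g p \<oplus>\<^bsub>M\<^esub> lin_ext K M g q"
      by simp
  next
    fix k p assume k: "k \<in> carrier K" and p: "p \<in> carrier (free_module K B)"
    have CB: "?s p \<subseteq> B" "finite (?s p)" using D[OF p] by auto
    have "lin_ext K M g (\<lambda>b. k \<otimes>\<^bsub>K\<^esub> p b) = (\<Oplus>\<^bsub>M\<^esub>b\<in>?s p. (k \<otimes>\<^bsub>K\<^esub> p b) \<odot>\<^bsub>M\<^esub> g b)"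
      by (rule lin_ext_superset[OF M C(3)[OF k p] g]) (use CB k in auto)
    also have "\<dots> = (\<Oplus>\<^bsub>M\<^esub>b\<in>?s p. k \<odot>\<^bsub>M\<^esub> (p b \<odot>\<^bsub>M\<^esub> g b))"
      using Pi[OF p CB(1)] CB(1) g k
      by (intro M.finsum_cong') (auto intro!: M.smult_assoc1 simp: D(1)[OF p])
    also have "\<dots> = k \<odot>\<^bsub>M\<^esub> lin_ext K M g p"
      unfolding lin_ext_def
      by (rule M.finsum_smult_ldistr[OF CB(2) k Pi[OF p CB(1)], symmetric])
    finally show "lin_ext K M g (k \<odot>\<^bsub>free_module K B\<^esub> p) = k \<odot>\<^bsub>M\<^esub> lin_ext K M g p"
      by simp
  qed
qed

lemma lin_ext_single:
  assumes "cring K" and M: "module K M" and "b \<in> B" "g \<in> B \<rightarrow> carrier M"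
  shows "lin_ext K M g (single K b) = g b"
proof -
  interpret M: module K M by fact
  have "lin_ext K M g (single K b) = (\<Oplus>\<^bsub>M\<^esub>c\<in>{b}. single K b c \<odot>\<^bsub>M\<^esub> g c)"
    by (rule lin_ext_superset[OF M free_module_closed(4)[OF assms(1,3)] assms(4)])
      (use assms in \<open>auto simp: single_def\<close>)
  also have "\<dots> = g b"
    using funcset_mem[OF assms(4,3)] by (subst M.finsum_insert) (simp_all add: single_def)
  finally show ?thesis .
qed

section \<open>Associative algebras, the word algebra and quotients\<close>

lemma ring_cong:
  assumes "ring R" and "carrier S = carrier R" "zero S = zero R" "add S = add R"
    "one S = one R" "mult S = mult R"
  shows "ring S"
proof -
  interpret ring R by fact
  show ?thesis
  proof (rule ringI)
    show "abelian_group S"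
      by (rule abelian_group_cong[OF is_abelian_group assms(2-4)])
    show "monoid S"
      by (rule monoidI) (simp_all add: assms(2-) m_assoc)
  qed (simp_all add: assms(2-) l_distr r_distr)
qed

text \<open>A unital associative, not necessarily commutative, \<open>K\<close>-algebra.\<close>

locale assoc_alg = module K B + B: ring B for K (structure) and B (structure) +
  assumes smult_mult_l: "\<lbrakk>k \<in> carrier K; x \<in> carrier B; y \<in> carrier B\<rbrakk> \<Longrightarrow>
      (k \<odot>\<^bsub>B\<^esub> x) \<otimes>\<^bsub>B\<^esub> y = k \<odot>\<^bsub>B\<^esub> (x \<otimes>\<^bsub>B\<^esub> y)"
    and smult_mult_r: "\<lbrakk>k \<in> carrier K; x \<in> carrier B; y \<in> carrier B\<rbrakk> \<Longrightarrow>
      x \<otimes>\<^bsub>B\<^esub> (k \<odot>\<^bsub>B\<^esub> y) = k \<odot>\<^bsub>B\<^esub> (x \<otimes>\<^bsub>B\<^esub> y)"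

lemma assoc_algI:
  assumes "module K B" "ring B"
    and "\<And>k x y. \<lbrakk>k \<in> carrier K; x \<in> carrier B; y \<in> carrier B\<rbrakk> \<Longrightarrow>
      (k \<odot>\<^bsub>B\<^esub> x) \<otimes>\<^bsub>B\<^esub> y = k \<odot>\<^bsub>B\<^esub> (x \<otimes>\<^bsub>B\<^esub> y)"
    and "\<And>k x y. \<lbrakk>k \<in> carrier K; x \<in> carrier B; y \<in> carrier B\<rbrakk> \<Longrightarrow>
      x \<otimes>\<^bsub>B\<^esub> (k \<odot>\<^bsub>B\<^esub> y) = k \<odot>\<^bsub>B\<^esub> (x \<otimes>\<^bsub>B\<^esub> y)"
  shows "assoc_alg K B"
  using assms by (simp add: assoc_alg_def assoc_alg_axioms_def)

lemma assoc_alg_lin_homs: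
  assumes "assoc_alg K B" and y: "y \<in> carrier B"
  shows "(\<lambda>x. x \<otimes>\<^bsub>B\<^esub> y) \<in> lin_hom K B B" and "(\<lambda>x. y \<otimes>\<^bsub>B\<^esub> x) \<in> lin_hom K B B"
proof -
  interpret assoc_alg K B by fact
  show "(\<lambda>x. x \<otimes>\<^bsub>B\<^esub> y) \<in> lin_hom K B B" "(\<lambda>x. y \<otimes>\<^bsub>B\<^esub> x) \<in> lin_hom K B B"
    using y by (auto intro!: lin_homI simp: B.l_distr B.r_distr smult_mult_l smult_mult_r)
qed

lemma unital_alg_homD:
  assumes "h \<in> unital_alg_hom K B C"
  shows "h \<in> lin_hom K B C" "h \<in> ring_hom B C" "h \<one>\<^bsub>B\<^esub> = \<one>\<^bsub>C\<^esub>"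
    "x \<in> carrier B \<Longrightarrow> y \<in> carrier B \<Longrightarrow> h (x \<otimes>\<^bsub>B\<^esub> y) = h x \<otimes>\<^bsub>C\<^esub> h y"
  using assms by (auto simp: unital_alg_hom_def ring_hom_def intro!: lin_homI)

lemma unital_alg_homI:
  assumes "h \<in> lin_hom K B C" "h \<one>\<^bsub>B\<^esub> = \<one>\<^bsub>C\<^esub>"
    "\<And>x y. x \<in> carrier B \<Longrightarrow> y \<in> carrier B \<Longrightarrow> h (x \<otimes>\<^bsub>B\<^esub> y) = h x \<otimes>\<^bsub>C\<^esub> h y"
  shows "h \<in> unital_alg_hom K B C"
  using assms by (auto simp: unital_alg_hom_def ring_hom_def lin_hom_def)

lemma unital_alg_hom_kernel:
  assumes "assoc_alg K B" "assoc_alg K C" "h \<in> unital_alg_hom K B C"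
  shows "ideal (a_kernel B C h) B"
proof -
  interpret B: assoc_alg K B by fact
  interpret C: assoc_alg K C by fact
  interpret ring_hom_ring B C h
    by (rule ring_hom_ringI2[OF B.B.ring_axioms C.B.ring_axioms unital_alg_homD(2)[OF assms(3)]])
  show ?thesis by (rule kernel_is_ideal)
qed

lemma word_alg_sel [simp]:
  "carrier (word_alg K B) = carrier (free_module K (lists B))"
  "\<zero>\<^bsub>word_alg K B\<^esub> = (\<lambda>b. \<zero>\<^bsub>K\<^esub>)"
  "p \<oplus>\<^bsub>word_alg K B\<^esub> q = (\<lambda>b. p b \<oplus>\<^bsub>K\<^esub> q b)"
  "k \<odot>\<^bsub>word_alg K B\<^esub> p = (\<lambda>b. k \<otimes>\<^bsub>K\<^esub> p b)"
  "\<one>\<^bsub>word_alg K B\<^esub> = single K []"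
  by (simp_all add: word_alg_def free_module_def)

lemma word_alg_mult:
  "(p \<otimes>\<^bsub>word_alg K B\<^esub> q) w = (\<Oplus>\<^bsub>K\<^esub>i\<in>{..length w}. p (take i w) \<otimes>\<^bsub>K\<^esub> q (drop i w))"
  by (simp add: word_alg_def)

lemma word_alg_module:
  assumes "cring K"
  shows "module K (word_alg K B)"
  by (rule module_cong[OF free_module_module[OF assms]]) (simp_all add: word_alg_def)

lemma word_alg_single_mult:
  assumes "cring K"
  shows "single K u \<otimes>\<^bsub>word_alg K B\<^esub> single K v = single K (u @ v)"
proof
  fix w
  interpret cring K by fact
  have *: "(\<Oplus>\<^bsub>K\<^esub>i\<in>{..length w}. single K u (take i w) \<otimes>\<^bsub>K\<^esub> single K v (drop i w)) =
      (\<Oplus>\<^bsub>K\<^esub>i\<in>{..length w}. if length u = i then single K (u @ v) w else \<zero>\<^bsub>K\<^esub>)"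
  proof (rule finsum_cong')
    fix i assume "i \<in> {..length w}"
    then show "single K u (take i w) \<otimes>\<^bsub>K\<^esub> single K v (drop i w) =
        (if length u = i then single K (u @ v) w else \<zero>\<^bsub>K\<^esub>)"
      using append_take_drop_id[of i w]
      by (auto simp: single_def append_eq_conv_conj)
  qed (auto simp: single_def)
  show "(single K u \<otimes>\<^bsub>word_alg K B\<^esub> single K v) w = single K (u @ v) w"
  proof (cases "length u \<le> length w")
    case True
    then show ?thesis
      unfolding word_alg_mult * by (subst finsum_singleton) (auto simp: single_def)
  next
    case False
    then have "(\<Oplus>\<^bsub>K\<^esub>i\<in>{..length w}. if length u = i then single K (u @ v) w else \<zero>\<^bsub>K\<^esub>) =
        (\<Oplus>\<^bsub>K\<^esub>i\<in>{..length w}. \<zero>\<^bsub>K\<^esub>)"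
      by (intro finsum_cong') auto
    then show ?thesis
      using False unfolding word_alg_mult * by (auto simp: single_def finsum_zero)
  qed
qed

lemma word_alg_mult_closed:
  assumes "cring K" and p: "p \<in> carrier (word_alg K B)" and q: "q \<in> carrier (word_alg K B)"
  shows "p \<otimes>\<^bsub>word_alg K B\<^esub> q \<in> carrier (word_alg K B)"
proof -
  interpret cring K by fact
  note pD = free_module_carrierD[OF p[unfolded word_alg_sel]]
    and qD = free_module_carrierD[OF q[unfolded word_alg_sel]]
  let ?C = "(\<lambda>(u, v). u @ v) ` ({u. p u \<noteq> \<zero>\<^bsub>K\<^esub>} \<times> {v. q v \<noteq> \<zero>\<^bsub>K\<^esub>})"
  show ?thesis unfolding word_alg_sel
  proof (rule free_module_carrierI[of _ _ ?C])
    show "finite ?C" using pD(2) qD(2) by auto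
    show "?C \<subseteq> lists B"
    proof (rule image_subsetI)
      fix z assume "z \<in> {u. p u \<noteq> \<zero>\<^bsub>K\<^esub>} \<times> {v. q v \<noteq> \<zero>\<^bsub>K\<^esub>}"
      then show "(case z of (u, v) \<Rightarrow> u @ v) \<in> lists B"
        using pD(3)[of "fst z"] qD(3)[of "snd z"] by (simp add: split_beta mem_Times_iff)
    qed
    show "(p \<otimes>\<^bsub>word_alg K B\<^esub> q) w \<in> carrier K" for w
      using pD(1) qD(1) by (auto simp: word_alg_mult intro!: finsum_closed)
    fix w assume w: "w \<notin> ?C"
    have "p (take i w) \<otimes>\<^bsub>K\<^esub> q (drop i w) = \<zero>\<^bsub>K\<^esub>" for i
    proof (cases "p (take i w) = \<zero>\<^bsub>K\<^esub> \<or> q (drop i w) = \<zero>\<^bsub>K\<^esub>")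
      case False
      then have "(take i w, drop i w) \<in> {u. p u \<noteq> \<zero>\<^bsub>K\<^esub>} \<times> {v. q v \<noteq> \<zero>\<^bsub>K\<^esub>}" by auto
      from imageI[OF this, of "\<lambda>(u, v). u @ v"] have "w \<in> ?C" by simp
      with w show ?thesis by simp
    qed (use pD(1) qD(1) in auto)
    then show "(p \<otimes>\<^bsub>word_alg K B\<^esub> q) w = \<zero>\<^bsub>K\<^esub>"
      by (simp add: word_alg_mult finsum_zero)
  qed
qed

lemma word_alg_mult_lin:
  assumes "cring K" and q: "q \<in> carrier (word_alg K B)"
  shows "(\<lambda>p. p \<otimes>\<^bsub>word_alg K B\<^esub> q) \<in> lin_hom K (word_alg K B) (word_alg K B)"
    and "(\<lambda>p. q \<otimes>\<^bsub>word_alg K B\<^esub> p) \<in> lin_hom K (word_alg K B) (word_alg K B)"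
proof -
  interpret cring K by fact
  note C = word_alg_mult_closed[OF assms(1)]
  have D: "p w \<in> carrier K" if "p \<in> carrier (word_alg K B)" for p w
    using free_module_carrierD(1)[of p K "lists B" w] that by simp
  have Pi: "(\<lambda>i. p (take i w) \<otimes>\<^bsub>K\<^esub> q (drop i w)) \<in> {..length w} \<rightarrow> carrier K"
    if "p \<in> carrier (word_alg K B)" "q \<in> carrier (word_alg K B)" for p q w
    using D[OF that(1)] D[OF that(2)] by auto
  show "(\<lambda>p. p \<otimes>\<^bsub>word_alg K B\<^esub> q) \<in> lin_hom K (word_alg K B) (word_alg K B)"
  proof (rule lin_homI)
    fix x y assume x: "x \<in> carrier (word_alg K B)" and y: "y \<in> carrier (word_alg K B)"
    show "(x \<oplus>\<^bsub>word_alg K B\<^esub> y) \<otimes>\<^bsub>word_alg K B\<^esub> q =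
        x \<otimes>\<^bsub>word_alg K B\<^esub> q \<oplus>\<^bsub>word_alg K B\<^esub> y \<otimes>\<^bsub>word_alg K B\<^esub> q"
      using finsum_addf[OF Pi[OF x q] Pi[OF y q]] D[OF x] D[OF y] D[OF q]
      by (simp add: fun_eq_iff word_alg_mult l_distr)
  next
    fix k x assume k: "k \<in> carrier K" and x: "x \<in> carrier (word_alg K B)"
    show "(k \<odot>\<^bsub>word_alg K B\<^esub> x) \<otimes>\<^bsub>word_alg K B\<^esub> q = k \<odot>\<^bsub>word_alg K B\<^esub> (x \<otimes>\<^bsub>word_alg K B\<^esub> q)"
      using finsum_rdistr[OF _ k Pi[OF x q]] D[OF x] D[OF q] k
      by (simp add: fun_eq_iff word_alg_mult m_assoc)
  qed (rule C[OF _ q])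
  show "(\<lambda>p. q \<otimes>\<^bsub>word_alg K B\<^esub> p) \<in> lin_hom K (word_alg K B) (word_alg K B)"
  proof (rule lin_homI)
    fix x y assume x: "x \<in> carrier (word_alg K B)" and y: "y \<in> carrier (word_alg K B)"
    show "q \<otimes>\<^bsub>word_alg K B\<^esub> (x \<oplus>\<^bsub>word_alg K B\<^esub> y) =
        q \<otimes>\<^bsub>word_alg K B\<^esub> x \<oplus>\<^bsub>word_alg K B\<^esub> q \<otimes>\<^bsub>word_alg K B\<^esub> y"
      using finsum_addf[OF Pi[OF q x] Pi[OF q y]] D[OF x] D[OF y] D[OF q]
      by (simp add: fun_eq_iff word_alg_mult r_distr)
  next
    fix k x assume k: "k \<in> carrier K" and x: "x \<in> carrier (word_alg K B)"
    show "q \<otimes>\<^bsub>word_alg K B\<^esub> (k \<odot>\<^bsub>word_alg K B\<^esub> x) = k \<odot>\<^bsub>word_alg K B\<^esub> (q \<otimes>\<^bsub>word_alg K B\<^esub> x)"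
      using finsum_rdistr[OF _ k Pi[OF q x]] D[OF x] D[OF q] k
      by (simp add: fun_eq_iff word_alg_mult m_lcomm)
  qed (rule C[OF q])
qed

lemma word_alg_lin_eqI:
  assumes "cring K" "module K M" "f \<in> lin_hom K (word_alg K B) M" "g \<in> lin_hom K (word_alg K B) M"
    and "\<And>w. w \<in> lists B \<Longrightarrow> f (single K w) = g (single K w)"
    and "p \<in> carrier (word_alg K B)"
  shows "f p = g p"
  by (rule free_module_lin_eqI[OF assms(1) _ _ _ _ assms(2-6)]) (simp_all add: word_alg_def)

text \<open>Associativity and the unit laws are equalities of maps that are linear in each argument, so they
  follow from the same laws for concatenation of words.\<close>

lemma word_alg_assoc_alg:
  assumes "cring K"
  shows "assoc_alg K (word_alg K B)"
proof -
  let ?W = "word_alg K B"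
  interpret cring K by fact
  note W = word_alg_module[OF assms] and cl = word_alg_mult_closed[OF assms]
    and lin = word_alg_mult_lin[OF assms] and eqI = word_alg_lin_eqI[OF assms]
    and sm = word_alg_single_mult[OF assms]
  interpret W: module K ?W by (rule W)
  have sc: "single K w \<in> carrier ?W" if "w \<in> lists B" for w
    using free_module_closed(4)[OF assms that] by simp
  have id: "(\<lambda>p. p) \<in> lin_hom K ?W ?W" by (rule lin_homI) auto
  have a1: "(single K u \<otimes>\<^bsub>?W\<^esub> single K v) \<otimes>\<^bsub>?W\<^esub> r = single K u \<otimes>\<^bsub>?W\<^esub> (single K v \<otimes>\<^bsub>?W\<^esub> r)"
    if "u \<in> lists B" "v \<in> lists B" "r \<in> carrier ?W" for u v r
    by (rule eqI[OF W lin(2) lin_hom_comp[OF lin(2) lin(2)] _ that(3)])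
      (use that in \<open>simp_all only: cl sc sm append_assoc append_in_lists_conv simp_thms\<close>)
  have a2: "(single K u \<otimes>\<^bsub>?W\<^esub> q) \<otimes>\<^bsub>?W\<^esub> r = single K u \<otimes>\<^bsub>?W\<^esub> (q \<otimes>\<^bsub>?W\<^esub> r)"
    if "u \<in> lists B" "q \<in> carrier ?W" "r \<in> carrier ?W" for u q r
    by (rule eqI[OF W lin_hom_comp[OF lin(2) lin(1)] lin_hom_comp[OF lin(1) lin(2)] _ that(2)])
      (use that in \<open>simp_all only: cl sc a1\<close>)
  have a3: "(p \<otimes>\<^bsub>?W\<^esub> q) \<otimes>\<^bsub>?W\<^esub> r = p \<otimes>\<^bsub>?W\<^esub> (q \<otimes>\<^bsub>?W\<^esub> r)"
    if "p \<in> carrier ?W" "q \<in> carrier ?W" "r \<in> carrier ?W" for p q r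
    by (rule eqI[OF W lin_hom_comp[OF lin(1) lin(1)] lin(1) _ that(1)])
      (use that in \<open>simp_all only: cl sc a2\<close>)
  have one: "\<one>\<^bsub>?W\<^esub> \<otimes>\<^bsub>?W\<^esub> p = p" "p \<otimes>\<^bsub>?W\<^esub> \<one>\<^bsub>?W\<^esub> = p" if "p \<in> carrier ?W" for p
    by (rule eqI[OF W lin(2) id _ that], simp_all only: word_alg_sel(5) sc sm append_Nil lists.Nil)
      (rule eqI[OF W lin(1) id _ that], simp_all only: sc sm append_Nil2 lists.Nil)
  show ?thesis
  proof (rule assoc_algI[OF W])
    show "ring ?W"
    proof (rule ringI)
      show "monoid ?W"
        by (rule monoidI) (use cl a3 one sc in \<open>simp_all only: word_alg_sel(5) lists.Nil\<close>)
    qed (rule W.M.abelian_group_axioms, (rule lin_homD(2)[OF lin(1)] lin_homD(2)[OF lin(2)], assumption+)+)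
  qed ((rule lin_homD(3)[OF lin(1)] lin_homD(3)[OF lin(2)], assumption+)+)
qed

text \<open>The quotient of an associative \<open>K\<close>-algebra by a two-sided ideal; scalars act on a coset
  through its members.\<close>

definition alg_quot ::
  "('k, 'b, 's) module_scheme \<Rightarrow> 'b set \<Rightarrow> ('k, 'b set) module" where
  "alg_quot B J = \<lparr>carrier = carrier (B Quot J), mult = mult (B Quot J), one = one (B Quot J),
     zero = zero (B Quot J), add = add (B Quot J),
     smult = (\<lambda>k X. \<Union>p\<in>X. J +>\<^bsub>B\<^esub> (k \<odot>\<^bsub>B\<^esub> p))\<rparr>"

locale alg_ideal = assoc_alg K B + J: ideal J B for K (structure) and B (structure) and J
begin

lemma ideal_smult_closed:
  assumes "k \<in> carrier K" "x \<in> J"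
  shows "k \<odot>\<^bsub>B\<^esub> x \<in> J"
proof -
  have x: "x \<in> carrier B" using assms J.a_subset by auto
  have "(k \<odot>\<^bsub>B\<^esub> \<one>\<^bsub>B\<^esub>) \<otimes>\<^bsub>B\<^esub> x \<in> J"
    using assms by (intro J.I_l_closed) auto
  then show ?thesis
    using assms(1) x by (simp add: smult_mult_l)
qed

lemma coset_eq_iff:
  assumes "x \<in> carrier B" "y \<in> carrier B"
  shows "J +>\<^bsub>B\<^esub> x = J +>\<^bsub>B\<^esub> y \<longleftrightarrow> x \<ominus>\<^bsub>B\<^esub> y \<in> J"
  using B.quotient_eq_iff_same_a_r_cos[OF J.ideal_axioms] assms by simp

lemma quot_carrier: "carrier (alg_quot B J) = (\<lambda>x. J +>\<^bsub>B\<^esub> x) ` carrier B"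
  by (auto simp: alg_quot_def FactRing_simps)

lemma quot_carrierE:
  assumes "X \<in> carrier (alg_quot B J)"
  obtains x where "x \<in> carrier B" "X = J +>\<^bsub>B\<^esub> x"
  using assms by (auto simp: quot_carrier)

lemma coset_closed: "x \<in> carrier B \<Longrightarrow> J +>\<^bsub>B\<^esub> x \<in> carrier (alg_quot B J)"
  by (simp add: quot_carrier)

lemma quot_sel:
  "\<zero>\<^bsub>alg_quot B J\<^esub> = J" "\<one>\<^bsub>alg_quot B J\<^esub> = J +>\<^bsub>B\<^esub> \<one>\<^bsub>B\<^esub>"
  "x \<in> carrier B \<Longrightarrow> y \<in> carrier B \<Longrightarrow>
    (J +>\<^bsub>B\<^esub> x) \<oplus>\<^bsub>alg_quot B J\<^esub> (J +>\<^bsub>B\<^esub> y) = J +>\<^bsub>B\<^esub> (x \<oplus>\<^bsub>B\<^esub> y)"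
  "x \<in> carrier B \<Longrightarrow> y \<in> carrier B \<Longrightarrow>
    (J +>\<^bsub>B\<^esub> x) \<otimes>\<^bsub>alg_quot B J\<^esub> (J +>\<^bsub>B\<^esub> y) = J +>\<^bsub>B\<^esub> (x \<otimes>\<^bsub>B\<^esub> y)"
  by (simp_all add: alg_quot_def FactRing_def J.a_rcos_sum J.rcoset_mult_add)

lemma quot_smult:
  assumes k: "k \<in> carrier K" and x: "x \<in> carrier B"
  shows "k \<odot>\<^bsub>alg_quot B J\<^esub> (J +>\<^bsub>B\<^esub> x) = J +>\<^bsub>B\<^esub> (k \<odot>\<^bsub>B\<^esub> x)"
proof -
  have "J +>\<^bsub>B\<^esub> (k \<odot>\<^bsub>B\<^esub> p) = J +>\<^bsub>B\<^esub> (k \<odot>\<^bsub>B\<^esub> x)" if p: "p \<in> J +>\<^bsub>B\<^esub> x" for p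
  proof -
    obtain j where j: "j \<in> J" "p = j \<oplus>\<^bsub>B\<^esub> x"
      using p by (auto simp: a_r_coset_def r_coset_def)
    then have jB: "j \<in> carrier B" using J.a_subset by auto
    have "k \<odot>\<^bsub>B\<^esub> p \<ominus>\<^bsub>B\<^esub> k \<odot>\<^bsub>B\<^esub> x = k \<odot>\<^bsub>B\<^esub> j"
      using j jB k x by (simp add: smult_r_distr a_minus_def M.a_assoc M.r_neg)
    then show ?thesis
      using ideal_smult_closed[OF k j(1)] j jB k x by (subst coset_eq_iff) auto
  qed
  moreover have "x \<in> J +>\<^bsub>B\<^esub> x" by (rule J.a_rcos_self[OF x])
  ultimately have "(\<Union>p\<in>J +>\<^bsub>B\<^esub> x. J +>\<^bsub>B\<^esub> (k \<odot>\<^bsub>B\<^esub> p)) = J +>\<^bsub>B\<^esub> (k \<odot>\<^bsub>B\<^esub> x)"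
    by blast
  then show ?thesis
    by (simp add: alg_quot_def)
qed

lemma quot_assoc_alg: "assoc_alg K (alg_quot B J)"
proof (rule assoc_algI)
  note simps = partial_object.simps monoid.simps ring.simps
  show R: "ring (alg_quot B J)"
    by (rule ring_cong[OF J.quotient_is_ring]) (simp_all only: alg_quot_def simps)
  show "module K (alg_quot B J)"
  proof (rule moduleI)
    show "cring K" by (rule R.cring_axioms)
    show "abelian_group (alg_quot B J)" by (rule ringE(1)[OF R])
  qed (auto elim!: quot_carrierE simp: quot_smult quot_sel coset_closed smult_l_distr smult_r_distr
      smult_assoc1)
qed (auto elim!: quot_carrierE simp: quot_smult quot_sel smult_mult_l smult_mult_r)

lemma coset_unital_alg_hom: "(\<lambda>x. J +>\<^bsub>B\<^esub> x) \<in> unital_alg_hom K B (alg_quot B J)"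
proof (rule unital_alg_homI)
  show "(\<lambda>x. J +>\<^bsub>B\<^esub> x) \<in> lin_hom K B (alg_quot B J)"
    by (rule lin_homI) (simp_all add: coset_closed quot_sel quot_smult)
qed (simp_all add: quot_sel)

end

section \<open>The tensor algebra and its universal property\<close>

lemma Tens_eq_alg_quot: "Tens K V = alg_quot (word_alg K (carrier V)) (tens_ideal K V)"
  by (simp add: Tens_def alg_quot_def Let_def)

lemma word_alg_single_closed:
  assumes "cring K" "w \<in> lists B"
  shows "single K w \<in> carrier (word_alg K B)"
  using free_module_closed(4)[OF assms] by simp

lemma tens_rels_subset:
  assumes "module K V"
  shows "tens_rels K V \<subseteq> carrier (word_alg K (carrier V))"
proof -
  let ?W = "word_alg K (carrier V)"
  interpret V: module K V by fact
  interpret W: module K ?W by (rule word_alg_module[OF V.R.cring_axioms])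
  have s: "single K [v] \<in> carrier ?W" if "v \<in> carrier V" for v
    by (rule word_alg_single_closed[OF V.R.cring_axioms]) (use that in simp)
  show ?thesis
    unfolding tens_rels_def Let_def
    by (auto intro!: W.minus_closed W.a_closed W.smult_closed s V.a_closed V.smult_closed
        simp del: word_alg_sel)
qed

lemma tens_alg_ideal:
  assumes "module K V"
  shows "alg_ideal K (word_alg K (carrier V)) (tens_ideal K V)"
proof -
  interpret V: module K V by fact
  interpret W: assoc_alg K "word_alg K (carrier V)"
    by (rule word_alg_assoc_alg[OF V.R.cring_axioms])
  show ?thesis
    unfolding alg_ideal_def tens_ideal_def
    using W.assoc_alg_axioms W.B.genideal_ideal[OF tens_rels_subset[OF assms]] by simp
qed

lemma Tens_assoc_alg:
  assumes "module K V"
  shows "assoc_alg K (Tens K V)"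
  unfolding Tens_eq_alg_quot by (rule alg_ideal.quot_assoc_alg[OF tens_alg_ideal[OF assms]])

lemma tens_incl_lin_hom:
  assumes "module K V"
  shows "tens_incl K V \<in> lin_hom K V (Tens K V)"
proof -
  let ?W = "word_alg K (carrier V)" and ?J = "tens_ideal K V"
  interpret V: module K V by fact
  interpret I: alg_ideal K ?W ?J by (rule tens_alg_ideal[OF assms])
  have s: "single K [v] \<in> carrier ?W" if "v \<in> carrier V" for v
    by (rule word_alg_single_closed[OF V.R.cring_axioms]) (use that in simp)
  have rel: "x \<in> ?J" if "x \<in> tens_rels K V" for x
    using I.B.genideal_self[OF tens_rels_subset[OF assms]] that by (auto simp: tens_ideal_def)
  show ?thesis
  proof (rule lin_homI)
    fix v assume v: "v \<in> carrier V"
    show "tens_incl K V v \<in> carrier (Tens K V)"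
      unfolding tens_incl_def Tens_eq_alg_quot by (rule I.coset_closed[OF s[OF v]])
  next
    fix v w assume v: "v \<in> carrier V" and w: "w \<in> carrier V"
    have "single K [v \<oplus>\<^bsub>V\<^esub> w] \<ominus>\<^bsub>?W\<^esub> (single K [v] \<oplus>\<^bsub>?W\<^esub> single K [w]) \<in> ?J"
      by (rule rel) (use v w in \<open>auto simp only: tens_rels_def Let_def\<close>)
    then have "?J +>\<^bsub>?W\<^esub> single K [v \<oplus>\<^bsub>V\<^esub> w] = ?J +>\<^bsub>?W\<^esub> (single K [v] \<oplus>\<^bsub>?W\<^esub> single K [w])"
      by (subst I.coset_eq_iff) (use v w s in \<open>simp_all only: V.a_closed I.M.a_closed\<close>)
    then show "tens_incl K V (v \<oplus>\<^bsub>V\<^esub> w) = tens_incl K V v \<oplus>\<^bsub>Tens K V\<^esub> tens_incl K V w"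
      unfolding tens_incl_def Tens_eq_alg_quot using I.quot_sel(3)[OF s[OF v] s[OF w]] by simp
  next
    fix k v assume k: "k \<in> carrier K" and v: "v \<in> carrier V"
    have "single K [k \<odot>\<^bsub>V\<^esub> v] \<ominus>\<^bsub>?W\<^esub> k \<odot>\<^bsub>?W\<^esub> single K [v] \<in> ?J"
      by (rule rel) (use k v in \<open>auto simp only: tens_rels_def Let_def\<close>)
    then have "?J +>\<^bsub>?W\<^esub> single K [k \<odot>\<^bsub>V\<^esub> v] = ?J +>\<^bsub>?W\<^esub> (k \<odot>\<^bsub>?W\<^esub> single K [v])"
      by (subst I.coset_eq_iff) (use k v s in \<open>simp_all only: V.smult_closed I.smult_closed\<close>)
    then show "tens_incl K V (k \<odot>\<^bsub>V\<^esub> v) = k \<odot>\<^bsub>Tens K V\<^esub> tens_incl K V v"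
      unfolding tens_incl_def Tens_eq_alg_quot using I.quot_smult[OF k s[OF v]] by simp
  qed
qed

text \<open>Every tensor is obtained from \<open>0\<close> and \<open>1\<close> by linear combinations and by multiplying with
  generators on the right, the side on which \<open>A\<close> acts.\<close>

lemma tens_induct [consumes 2, case_names zero one add smult mult]:
  assumes V: "module K V" and t: "t \<in> carrier (Tens K V)"
    and zero: "P \<zero>\<^bsub>Tens K V\<^esub>" and one: "P \<one>\<^bsub>Tens K V\<^esub>"
    and add: "\<And>s t. s \<in> carrier (Tens K V) \<Longrightarrow> t \<in> carrier (Tens K V) \<Longrightarrow> P s \<Longrightarrow> P t \<Longrightarrow>
      P (s \<oplus>\<^bsub>Tens K V\<^esub> t)"
    and smult: "\<And>k t. k \<in> carrier K \<Longrightarrow> t \<in> carrier (Tens K V) \<Longrightarrow> P t \<Longrightarrow> P (k \<odot>\<^bsub>Tens K V\<^esub> t)"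
    and mult: "\<And>t v. t \<in> carrier (Tens K V) \<Longrightarrow> v \<in> carrier V \<Longrightarrow> P t \<Longrightarrow>
      P (t \<otimes>\<^bsub>Tens K V\<^esub> tens_incl K V v)"
  shows "P t"
proof -
  let ?W = "word_alg K (carrier V)" and ?J = "tens_ideal K V"
  interpret V: module K V by fact
  interpret I: alg_ideal K ?W ?J by (rule tens_alg_ideal[OF assms(1)])
  note s = word_alg_single_closed[OF V.R.cring_axioms, of _ "carrier V"]
  note T = Tens_eq_alg_quot[of K V]
  have words: "P (?J +>\<^bsub>?W\<^esub> single K w)" if "w \<in> lists (carrier V)" for w
    using that
  proof (induction w rule: rev_induct)
    case Nil
    then show ?case using one by (simp add: T I.quot_sel(2))
  next
    case (snoc v w)
    then have w: "w \<in> lists (carrier V)" and v: "v \<in> carrier V" by auto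
    have v': "[v] \<in> lists (carrier V)" using v by simp
    have "?J +>\<^bsub>?W\<^esub> single K (w @ [v]) = (?J +>\<^bsub>?W\<^esub> single K w) \<otimes>\<^bsub>Tens K V\<^esub> tens_incl K V v"
      unfolding T tens_incl_def I.quot_sel(4)[OF s[OF w] s[OF v']]
        word_alg_single_mult[OF V.R.cring_axioms] ..
    then show ?case
      using mult[OF I.coset_closed[OF s[OF w], folded T] v snoc.IH[OF w]] by simp
  qed
  obtain p where p: "p \<in> carrier ?W" and tp: "t = ?J +>\<^bsub>?W\<^esub> p"
    using t I.quot_carrierE unfolding T by blast
  have cW: "carrier (free_module K (lists (carrier V))) = carrier ?W" by simp
  have "P (?J +>\<^bsub>?W\<^esub> p)"
    using V.R.cring_axioms p[folded cW]
  proof (induction rule: free_module_induct)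
    case zero
    have "?J +>\<^bsub>?W\<^esub> \<zero>\<^bsub>?W\<^esub> = ?J"
      by (rule I.M.a_coset_add_zero[OF I.J.a_subset])
    then show ?case using assms(3) by (simp add: T I.quot_sel(1))
  next
    case (add p q)
    then have pq: "p \<in> carrier ?W" "q \<in> carrier ?W" by simp_all
    from assms(5)[OF I.coset_closed[OF pq(1), folded T] I.coset_closed[OF pq(2), folded T]] add(3,4)
    show ?case unfolding T I.quot_sel(3)[OF pq] word_alg_sel by blast
  next
    case (single k w)
    from smult[OF single(1) I.coset_closed[OF s[OF single(2)], folded T] words[OF single(2)]]
    show ?case unfolding T I.quot_smult[OF single(1) s[OF single(2)]] word_alg_sel .
  qed
  then show ?thesis unfolding tp .
qed

text \<open>The product in \<open>B\<close> of the images of the letters of a word under \<open>f\<close>.\<close>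

definition word_prod :: "('k, 'c, 's) module_scheme \<Rightarrow> ('b \<Rightarrow> 'c) \<Rightarrow> 'b list \<Rightarrow> 'c" where
  "word_prod B f w = foldr (\<lambda>v r. f v \<otimes>\<^bsub>B\<^esub> r) w \<one>\<^bsub>B\<^esub>"

lemma word_alg_lift:
  assumes B: "assoc_alg K B" and f: "f \<in> S \<rightarrow> carrier B"
  shows "lin_ext K B (word_prod B f) \<in> unital_alg_hom K (word_alg K S) B"
    and "w \<in> lists S \<Longrightarrow> lin_ext K B (word_prod B f) (single K w) = word_prod B f w"
proof -
  interpret B: assoc_alg K B by fact
  let ?W = "word_alg K S" and ?h = "lin_ext K B (word_prod B f)"
  note cr = B.R.cring_axioms
  have cl: "word_prod B f w \<in> carrier B" if "w \<in> lists S" for w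
    using that by (induction w) (use f in \<open>auto simp: word_prod_def\<close>)
  have app: "word_prod B f (u @ w) = word_prod B f u \<otimes>\<^bsub>B\<^esub> word_prod B f w"
    if "u \<in> lists S" "w \<in> lists S" for u w
    using that(1)
  proof (induction u)
    case Nil
    then show ?case using cl[OF that(2)] by (simp add: word_prod_def)
  next
    case (Cons a u)
    then show ?case
      using cl[OF that(2)] cl[OF Cons.hyps(2)] funcset_mem[OF f Cons.hyps(1)]
      by (simp add: word_prod_def B.B.m_assoc)
  qed
  have lin: "?h \<in> lin_hom K ?W B"
    using lin_ext_lin_hom[OF cr B.module_axioms, of "word_prod B f" "lists S"] cl
    by (simp add: lin_hom_def)
  show sg: "?h (single K w) = word_prod B f w" if "w \<in> lists S" for w
    by (rule lin_ext_single[OF cr B.module_axioms that]) (use cl in auto)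
  note s = word_alg_single_closed[OF cr]
  note Wlin = word_alg_mult_lin[OF cr] and Blin = assoc_alg_lin_homs[OF B]
  have hc: "?h p \<in> carrier B" if "p \<in> carrier ?W" for p
    by (rule lin_homD(1)[OF lin that])
  have m1: "?h (single K u \<otimes>\<^bsub>?W\<^esub> q) = ?h (single K u) \<otimes>\<^bsub>B\<^esub> ?h q"
    if u: "u \<in> lists S" and q: "q \<in> carrier ?W" for u q
    by (rule word_alg_lin_eqI[OF cr B.module_axioms lin_hom_comp[OF Wlin(2)[OF s[OF u]] lin]
          lin_hom_comp[OF lin Blin(2)[OF hc[OF s[OF u]]]] _ q])
      (use u in \<open>simp only: word_alg_single_mult[OF cr] sg app append_in_lists_conv simp_thms\<close>)
  have m2: "?h (p \<otimes>\<^bsub>?W\<^esub> q) = ?h p \<otimes>\<^bsub>B\<^esub> ?h q"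
    if p: "p \<in> carrier ?W" and q: "q \<in> carrier ?W" for p q
    by (rule word_alg_lin_eqI[OF cr B.module_axioms lin_hom_comp[OF Wlin(1)[OF q] lin]
          lin_hom_comp[OF lin Blin(1)[OF hc[OF q]]] _ p])
      (rule m1[OF _ q])
  show "?h \<in> unital_alg_hom K ?W B"
    by (rule unital_alg_homI[OF lin]) (simp add: sg, simp add: word_prod_def, rule m2)
qed

text \<open>A linear map into an associative algebra kills the relations of the tensor algebra, so the
  induced map is constant on cosets and the choice of member in \<open>tens_lift\<close> is immaterial.\<close>

lemma tens_lift:
  assumes V: "module K V" and B: "assoc_alg K B" and f: "f \<in> lin_hom K V B"
  shows "tens_lift K B f \<in> unital_alg_hom K (Tens K V) B"
    and "v \<in> carrier V \<Longrightarrow> tens_lift K B f (tens_incl K V v) = f v"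
proof -
  let ?W = "word_alg K (carrier V)" and ?J = "tens_ideal K V"
  let ?h = "lin_ext K B (word_prod B f)"
  interpret V: module K V by fact
  interpret B: assoc_alg K B by fact
  interpret I: alg_ideal K ?W ?J by (rule tens_alg_ideal[OF V])
  note cr = V.R.cring_axioms
  note T = Tens_eq_alg_quot[of K V]
  have fc: "f \<in> carrier V \<rightarrow> carrier B" using lin_homD(1)[OF f] by auto
  note h = word_alg_lift(1)[OF B fc] and hs = word_alg_lift(2)[OF B fc]
  note hD = unital_alg_homD[OF h]
  note hl = lin_homD[OF hD(1)]
  note s = word_alg_single_closed[OF cr, of _ "carrier V"]
  have s1: "single K [v] \<in> carrier ?W" if "v \<in> carrier V" for v
    by (rule s) (use that in simp)
  have h1: "?h (single K [v]) = f v" if "v \<in> carrier V" for v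
    using hs[of "[v]"] that lin_homD(1)[OF f] by (simp add: word_prod_def)
  have neg: "?h (p \<ominus>\<^bsub>?W\<^esub> q) = \<zero>\<^bsub>B\<^esub>"
    if p: "p \<in> carrier ?W" and q: "q \<in> carrier ?W" and eq: "?h p = ?h q" for p q
  proof -
    interpret ring_hom_ring ?W B ?h
      by (rule ring_hom_ringI2[OF I.B.ring_axioms B.B.ring_axioms hD(2)])
    have "?h (p \<ominus>\<^bsub>?W\<^esub> q) = ?h p \<oplus>\<^bsub>B\<^esub> \<ominus>\<^bsub>B\<^esub> ?h q"
      unfolding a_minus_def hl(2)[OF p I.M.a_inv_closed[OF q]] hom_a_inv[OF q] ..
    then show ?thesis unfolding eq B.M.r_neg[OF hl(1)[OF q]] .
  qed
  have "tens_rels K V \<subseteq> a_kernel ?W B ?h"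
  proof -
    have n1: "?h (single K [v \<oplus>\<^bsub>V\<^esub> w] \<ominus>\<^bsub>?W\<^esub> (single K [v] \<oplus>\<^bsub>?W\<^esub> single K [w])) = \<zero>\<^bsub>B\<^esub>"
      if "v \<in> carrier V" "w \<in> carrier V" for v w
      by (rule neg) (use that in \<open>simp_all only: s1 h1 V.a_closed I.M.a_closed hl lin_homD(2)[OF f]\<close>)
    have n2: "?h (single K [k \<odot>\<^bsub>V\<^esub> v] \<ominus>\<^bsub>?W\<^esub> k \<odot>\<^bsub>?W\<^esub> single K [v]) = \<zero>\<^bsub>B\<^esub>"
      if "k \<in> carrier K" "v \<in> carrier V" for k v
      by (rule neg) (use that in \<open>simp_all only: s1 h1 V.smult_closed I.smult_closed hl lin_homD(3)[OF f]\<close>)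
    have "?h r = \<zero>\<^bsub>B\<^esub>" if "r \<in> tens_rels K V" for r
      using that unfolding tens_rels_def Let_def
      by (elim UnE CollectE exE conjE) (simp_all only: n1 n2)
    then show ?thesis
      using tens_rels_subset[OF V] unfolding a_kernel_def' by (auto simp only: subset_iff mem_Collect_eq)
  qed
  then have ker: "?J \<subseteq> a_kernel ?W B ?h"
    unfolding tens_ideal_def
    by (rule I.B.genideal_minimal[OF unital_alg_hom_kernel[OF I.assoc_alg_axioms B h]])
  have coset: "tens_lift K B f (?J +>\<^bsub>?W\<^esub> p) = ?h p" if p: "p \<in> carrier ?W" for p
  proof -
    have "?h q = ?h p" if q: "q \<in> ?J +>\<^bsub>?W\<^esub> p" for q
    proof -
      obtain j where j: "j \<in> ?J" "q = j \<oplus>\<^bsub>?W\<^esub> p"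
        using q by (auto simp: a_r_coset_def r_coset_def simp del: word_alg_sel)
      then have "?h j = \<zero>\<^bsub>B\<^esub>" "j \<in> carrier ?W"
        using ker unfolding a_kernel_def' by auto
      then show ?thesis using hl(1)[OF p] hl(2)[OF _ p] unfolding j(2) by simp
    qed
    then have "?h ` (?J +>\<^bsub>?W\<^esub> p) = {?h p}"
      using I.J.a_rcos_self[OF p] by blast
    then show ?thesis
      unfolding tens_lift_def word_prod_def by (simp only: the_elem_eq)
  qed
  show "tens_lift K B f (tens_incl K V v) = f v" if "v \<in> carrier V"
    unfolding tens_incl_def coset[OF s1[OF that]] h1[OF that] ..
  show "tens_lift K B f \<in> unital_alg_hom K (Tens K V) B"
    unfolding T
  proof (rule unital_alg_homI)
    show "tens_lift K B f \<in> lin_hom K (alg_quot ?W ?J) B"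
      by (rule lin_homI; (elim I.quot_carrierE)?)
        (simp_all only: I.quot_sel I.quot_smult coset I.smult_closed I.M.a_closed hl)
    show "tens_lift K B f \<one>\<^bsub>alg_quot ?W ?J\<^esub> = \<one>\<^bsub>B\<^esub>"
      unfolding I.quot_sel(2) coset[OF I.B.one_closed] by (rule hD(3))
    show "tens_lift K B f (x \<otimes>\<^bsub>alg_quot ?W ?J\<^esub> y) = tens_lift K B f x \<otimes>\<^bsub>B\<^esub> tens_lift K B f y"
      if "x \<in> carrier (alg_quot ?W ?J)" "y \<in> carrier (alg_quot ?W ?J)" for x y
      using that by (elim I.quot_carrierE) (simp only: I.quot_sel coset I.B.m_closed hD(4))
  qed
qed

section \<open>The tensor algebra on two copies of an algebra\<close>

lemma dsum_sel [simp]: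
  "carrier (dsum V W) = carrier V \<times> carrier W"
  "\<zero>\<^bsub>dsum V W\<^esub> = (\<zero>\<^bsub>V\<^esub>, \<zero>\<^bsub>W\<^esub>)"
  "x \<oplus>\<^bsub>dsum V W\<^esub> y = (fst x \<oplus>\<^bsub>V\<^esub> fst y, snd x \<oplus>\<^bsub>W\<^esub> snd y)"
  "k \<odot>\<^bsub>dsum V W\<^esub> x = (k \<odot>\<^bsub>V\<^esub> fst x, k \<odot>\<^bsub>W\<^esub> snd x)"
  by (simp_all add: dsum_def split_beta)

lemma dsum_module:
  assumes "module K V" "module K W"
  shows "module K (dsum V W)"
proof -
  interpret V: module K V by fact
  interpret W: module K W by fact
  show ?thesis
  proof (rule moduleI)
    show "abelian_group (dsum V W)"
    proof (rule abelian_groupI)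
      fix x assume "x \<in> carrier (dsum V W)"
      then show "\<exists>y\<in>carrier (dsum V W). y \<oplus>\<^bsub>dsum V W\<^esub> x = \<zero>\<^bsub>dsum V W\<^esub>"
        by (intro bexI[of _ "(\<ominus>\<^bsub>V\<^esub> fst x, \<ominus>\<^bsub>W\<^esub> snd x)"]) (auto simp: V.M.l_neg W.M.l_neg)
    qed (auto simp: V.M.a_ac W.M.a_ac)
  qed (auto simp: V.R.cring_axioms V.smult_l_distr W.smult_l_distr V.smult_r_distr W.smult_r_distr
      V.smult_assoc1 W.smult_assoc1)
qed

lemma tens_lambda_rho_lin_hom:
  assumes "module K A"
  shows "tens_lambda K A \<in> lin_hom K A (Tens2 K A)" "tens_rho K A \<in> lin_hom K A (Tens2 K A)"
proof -
  interpret A: module K A by fact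
  have "(\<lambda>a. (a, \<zero>\<^bsub>A\<^esub>)) \<in> lin_hom K A (dsum A A)" "(\<lambda>a. (\<zero>\<^bsub>A\<^esub>, a)) \<in> lin_hom K A (dsum A A)"
    by (auto intro!: lin_homI)
  then show "tens_lambda K A \<in> lin_hom K A (Tens2 K A)" "tens_rho K A \<in> lin_hom K A (Tens2 K A)"
    using tens_incl_lin_hom[OF dsum_module[OF assms assms]]
    by (auto simp: tens_lambda_def[abs_def] tens_rho_def[abs_def] intro: lin_hom_comp)
qed

lemma tens_incl_eq_lambda_rho:
  assumes "module K A" "a \<in> carrier A" "b \<in> carrier A"
  shows "tens_incl K (dsum A A) (a, b) = tens_lambda K A a \<oplus>\<^bsub>Tens2 K A\<^esub> tens_rho K A b"
proof -
  interpret A: module K A by fact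
  show ?thesis
    using lin_homD(2)[OF tens_incl_lin_hom[OF dsum_module[OF assms(1,1)]],
        of "(a, \<zero>\<^bsub>A\<^esub>)" "(\<zero>\<^bsub>A\<^esub>, b)"] assms(2,3)
    by (simp add: tens_lambda_def tens_rho_def)
qed

lemma tens2_induct [consumes 2, case_names zero one add smult lambda rho]:
  assumes A: "module K A" and t: "t \<in> carrier (Tens2 K A)"
    and "P \<zero>\<^bsub>Tens2 K A\<^esub>" "P \<one>\<^bsub>Tens2 K A\<^esub>"
    and add: "\<And>s t. s \<in> carrier (Tens2 K A) \<Longrightarrow> t \<in> carrier (Tens2 K A) \<Longrightarrow> P s \<Longrightarrow> P t \<Longrightarrow>
      P (s \<oplus>\<^bsub>Tens2 K A\<^esub> t)"
    and "\<And>k t. k \<in> carrier K \<Longrightarrow> t \<in> carrier (Tens2 K A) \<Longrightarrow> P t \<Longrightarrow> P (k \<odot>\<^bsub>Tens2 K A\<^esub> t)"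
    and l: "\<And>t a. t \<in> carrier (Tens2 K A) \<Longrightarrow> a \<in> carrier A \<Longrightarrow> P t \<Longrightarrow>
      P (t \<otimes>\<^bsub>Tens2 K A\<^esub> tens_lambda K A a)"
    and r: "\<And>t a. t \<in> carrier (Tens2 K A) \<Longrightarrow> a \<in> carrier A \<Longrightarrow> P t \<Longrightarrow>
      P (t \<otimes>\<^bsub>Tens2 K A\<^esub> tens_rho K A a)"
  shows "P t"
proof -
  note AA = dsum_module[OF A A]
  interpret T: assoc_alg K "Tens2 K A" by (rule Tens_assoc_alg[OF AA])
  from AA t show ?thesis
  proof (induction rule: tens_induct)
    case (mult t v)
    obtain a b where v: "v = (a, b)" "a \<in> carrier A" "b \<in> carrier A"
      using mult(2) by auto
    have "t \<otimes>\<^bsub>Tens2 K A\<^esub> tens_incl K (dsum A A) v =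
        t \<otimes>\<^bsub>Tens2 K A\<^esub> tens_lambda K A a \<oplus>\<^bsub>Tens2 K A\<^esub> t \<otimes>\<^bsub>Tens2 K A\<^esub> tens_rho K A b"
      unfolding v(1) tens_incl_eq_lambda_rho[OF A v(2,3)]
      using lin_homD(1)[OF tens_lambda_rho_lin_hom(1)[OF A]]
        lin_homD(1)[OF tens_lambda_rho_lin_hom(2)[OF A]] v mult(1)
      by (intro T.B.r_distr) auto
    then show ?case
      using add[OF _ _ l[OF mult(1) v(2) mult(3)] r[OF mult(1) v(3) mult(3)]]
        lin_homD(1)[OF tens_lambda_rho_lin_hom(1)[OF A]]
        lin_homD(1)[OF tens_lambda_rho_lin_hom(2)[OF A]] v mult(1) by simp
  qed fact+
qed

lemma tens2_hom_eqI:
  assumes A: "module K A" and C: "module K C"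
    and g: "g \<in> unital_alg_hom K (Tens2 K A) C" and h: "h \<in> unital_alg_hom K (Tens2 K A) C"
    and eq: "\<And>a. a \<in> carrier A \<Longrightarrow> g (tens_lambda K A a) = h (tens_lambda K A a)"
      "\<And>a. a \<in> carrier A \<Longrightarrow> g (tens_rho K A a) = h (tens_rho K A a)"
    and t: "t \<in> carrier (Tens2 K A)"
  shows "g t = h t"
proof -
  interpret T: assoc_alg K "Tens2 K A" by (rule Tens_assoc_alg[OF dsum_module[OF A A]])
  note gD = unital_alg_homD[OF g] and hD = unital_alg_homD[OF h]
  note lr = lin_homD(1)[OF tens_lambda_rho_lin_hom(1)[OF A]]
    lin_homD(1)[OF tens_lambda_rho_lin_hom(2)[OF A]]
  note z = lin_hom_zero[OF gD(1) T.module_axioms C] lin_hom_zero[OF hD(1) T.module_axioms C]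
  from A t show ?thesis
    by (induction rule: tens2_induct)
      (simp_all only: z gD(3,4) hD(3,4) lin_homD(2,3)[OF gD(1)] lin_homD(2,3)[OF hD(1)] lr eq)
qed

section \<open>Evaluation in a square-zero extension\<close>

lemma Mag_simps [simp]:
  "Gen y \<in> Mag S \<longleftrightarrow> y \<in> S" "Prod s t \<in> Mag S \<longleftrightarrow> s \<in> Mag S \<and> t \<in> Mag S"
  by (auto simp: Mag_def)

lemma KMag_fields:
  "carrier (KMag K S) = carrier (free_module K (Mag S))"
  "add (KMag K S) = add (free_module K (Mag S))"
  "smult (KMag K S) = smult (free_module K (Mag S))"
  "zero (KMag K S) = zero (free_module K (Mag S))"
  by (simp_all add: KMag_def)

lemma KMag_module:
  assumes "cring K"
  shows "module K (KMag K S)"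
  by (rule module_cong[OF free_module_module[OF assms]]) (simp_all add: KMag_fields)

lemma KMag_lin_ext:
  assumes "module K M" "g \<in> Mag S \<rightarrow> carrier M"
  shows "lin_ext K M g \<in> lin_hom K (KMag K S) M"
    and "t \<in> Mag S \<Longrightarrow> lin_ext K M g (single K t) = g t"
proof -
  interpret M: module K M by fact
  show "lin_ext K M g \<in> lin_hom K (KMag K S) M"
    using lin_ext_lin_hom[OF M.R.cring_axioms assms] by (simp add: lin_hom_def KMag_fields)
  show "lin_ext K M g (single K t) = g t" if "t \<in> Mag S"
    by (rule lin_ext_single[OF M.R.cring_axioms assms(1) that assms(2)])
qed

lemma KMag_single_closed:
  assumes "cring K" "t \<in> Mag S"
  shows "single K t \<in> carrier (KMag K S)"
  using free_module_closed(4)[OF assms] by (simp add: KMag_fields)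

lemma mag_eval_closed:
  assumes "magmatic_algebra K A" "a \<in> S \<rightarrow> carrier A" "t \<in> Mag S"
  shows "mag_eval A a t \<in> carrier A"
  using assms(3)
proof (induction t)
  case (Gen y)
  then show ?case using assms(2) by auto
next
  case (Prod s t)
  then show ?case using magmatic_algebra.prod_closed[OF assms(1)] by simp
qed

lemma eval_at_lin:
  assumes "magmatic_algebra K A" "a \<in> S \<rightarrow> carrier A"
  shows "eval_at K A a \<in> lin_hom K (KMag K S) A"
    and "t \<in> Mag S \<Longrightarrow> eval_at K A a (single K t) = mag_eval A a t"
proof -
  have "mag_eval A a \<in> Mag S \<rightarrow> carrier A"
    using mag_eval_closed[OF assms] by (intro Pi_I)
  note L = KMag_lin_ext[OF magmatic_algebra.axioms(1)[OF assms(1)] this]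
  have eq: "eval_at K A a = lin_ext K A (mag_eval A a)"
    by (simp add: eval_at_def[abs_def])
  show "eval_at K A a \<in> lin_hom K (KMag K S) A"
    unfolding eq by (rule L(1))
  show "eval_at K A a (single K t) = mag_eval A a t" if "t \<in> Mag S"
    unfolding eq by (rule L(2)[OF that])
qed

lemma mag_eval_cong:
  assumes "t \<in> Mag S" "\<And>x. x \<in> S \<Longrightarrow> a x = b x"
  shows "mag_eval A a t = mag_eval A b t"
  using assms(1) by (induction t) (simp_all add: assms(2))

lemma eval_at_cong:
  assumes A: "magmatic_algebra K A" and a: "a \<in> S \<rightarrow> carrier A"
    and eq: "\<And>x. x \<in> S \<Longrightarrow> a x = b x" and \<omega>: "\<omega> \<in> carrier (KMag K S)"
  shows "eval_at K A a \<omega> = eval_at K A b \<omega>"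
proof -
  interpret A: magmatic_algebra K A by fact
  have b: "b \<in> S \<rightarrow> carrier A" using a eq by (auto simp: Pi_iff)
  show ?thesis
    by (rule free_module_lin_eqI[OF A.R.cring_axioms KMag_fields A.module_axioms
          eval_at_lin(1)[OF A a] eval_at_lin(1)[OF A b] _ \<omega>])
      (simp add: eval_at_lin(2)[OF A a] eval_at_lin(2)[OF A b] mag_eval_cong[OF _ eq])
qed

lemma mag_deriv_closed:
  assumes "cring K" "t \<in> Mag S"
  shows "mag_deriv K S x t \<in> carrier (Tens2 K (KMag K S))"
proof -
  note M = KMag_module[OF assms(1), of S]
  interpret T: assoc_alg K "Tens2 K (KMag K S)" by (rule Tens_assoc_alg[OF dsum_module[OF M M]])
  from assms(2) show ?thesis
    by (induction t)
      (auto intro!: T.M.a_closed T.B.m_closed lin_homD(1)[OF tens_lambda_rho_lin_hom(1)[OF M]]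
        lin_homD(1)[OF tens_lambda_rho_lin_hom(2)[OF M]] KMag_single_closed[OF assms(1)])
qed

lemma partial_deriv_lin:
  assumes "cring K"
  shows "partial_deriv K S x \<in> lin_hom K (KMag K S) (Tens2 K (KMag K S))"
    and "t \<in> Mag S \<Longrightarrow> partial_deriv K S x (single K t) = mag_deriv K S x t"
proof -
  note M = KMag_module[OF assms(1), of S]
  interpret T: assoc_alg K "Tens2 K (KMag K S)" by (rule Tens_assoc_alg[OF dsum_module[OF M M]])
  have "mag_deriv K S x \<in> Mag S \<rightarrow> carrier (Tens2 K (KMag K S))"
    using mag_deriv_closed[OF assms] by (intro Pi_I)
  note L = KMag_lin_ext[OF T.module_axioms this]
  have eq: "partial_deriv K S x = lin_ext K (Tens2 K (KMag K S)) (mag_deriv K S x)"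
    by (simp add: partial_deriv_def[abs_def])
  show "partial_deriv K S x \<in> lin_hom K (KMag K S) (Tens2 K (KMag K S))"
    unfolding eq by (rule L(1))
  show "partial_deriv K S x (single K t) = mag_deriv K S x t" if "t \<in> Mag S"
    unfolding eq by (rule L(2)[OF that])
qed

lemma tens_eval_hom:
  assumes A: "magmatic_algebra K A" and a: "a \<in> S \<rightarrow> carrier A"
  shows "tens_eval K A a \<in> unital_alg_hom K (Tens2 K (KMag K S)) (Tens2 K A)"
    and "t \<in> Mag S \<Longrightarrow> tens_eval K A a (tens_lambda K (KMag K S) (single K t)) =
      tens_lambda K A (mag_eval A a t)"
    and "t \<in> Mag S \<Longrightarrow> tens_eval K A a (tens_rho K (KMag K S) (single K t)) =
      tens_rho K A (mag_eval A a t)"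
proof -
  let ?M = "KMag K S"
  interpret A: magmatic_algebra K A by fact
  note cr = A.R.cring_axioms
  note M = KMag_module[OF cr, of S] and ev = eval_at_lin[OF A a]
  interpret M: module K ?M by (rule M)
  note AA = dsum_module[OF A.module_axioms A.module_axioms] and MM = dsum_module[OF M M]
  let ?f = "\<lambda>(\<alpha>, \<beta>). tens_incl K (dsum A A) (eval_at K A a \<alpha>, eval_at K A a \<beta>)"
  have "(\<lambda>x. (eval_at K A a (fst x), eval_at K A a (snd x))) \<in> lin_hom K (dsum ?M ?M) (dsum A A)"
    by (rule lin_homI) (auto simp: lin_homD[OF ev(1)])
  from lin_hom_comp[OF this tens_incl_lin_hom[OF AA]]
  have f: "?f \<in> lin_hom K (dsum ?M ?M) (Tens2 K A)"
    by (simp add: split_beta')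
  have eq: "tens_eval K A a = tens_lift K (Tens2 K A) ?f"
    by (simp add: tens_eval_def[abs_def])
  note L = tens_lift[OF MM Tens_assoc_alg[OF AA] f]
  have z: "eval_at K A a \<zero>\<^bsub>?M\<^esub> = \<zero>\<^bsub>A\<^esub>"
    by (rule lin_hom_zero[OF ev(1) M A.module_axioms])
  show "tens_eval K A a \<in> unital_alg_hom K (Tens2 K ?M) (Tens2 K A)"
    unfolding eq by (rule L(1))
  have L2: "tens_eval K A a (tens_incl K (dsum ?M ?M) (p, q)) =
      tens_incl K (dsum A A) (eval_at K A a p, eval_at K A a q)"
    if "p \<in> carrier ?M" "q \<in> carrier ?M" for p q
    unfolding eq using L(2)[of "(p, q)"] that by simp
  show "tens_eval K A a (tens_lambda K ?M (single K t)) = tens_lambda K A (mag_eval A a t)"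
    if "t \<in> Mag S"
    using L2[OF KMag_single_closed[OF cr that] M.zero_closed] ev(2)[OF that] z
    by (simp add: tens_lambda_def)
  show "tens_eval K A a (tens_rho K ?M (single K t)) = tens_rho K A (mag_eval A a t)"
    if "t \<in> Mag S"
    using L2[OF M.zero_closed KMag_single_closed[OF cr that]] ev(2)[OF that] z
    by (simp add: tens_rho_def)
qed

lemma in_variety_empty: "in_variety K ({} :: ('v, 'k) equation set) A \<longleftrightarrow> magmatic_algebra K A"
  by (simp add: in_variety_def)

lemma square_zero_ext_sel [simp]:
  "carrier (square_zero_ext A M) = carrier A \<times> carrier M"
  "\<zero>\<^bsub>square_zero_ext A M\<^esub> = (\<zero>\<^bsub>A\<^esub>, \<zero>\<^bsub>M\<^esub>)"
  "u \<oplus>\<^bsub>square_zero_ext A M\<^esub> v = (fst u \<oplus>\<^bsub>A\<^esub> fst v, snd u \<oplus>\<^bsub>M\<^esub> snd v)"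
  "k \<odot>\<^bsub>square_zero_ext A M\<^esub> u = (k \<odot>\<^bsub>A\<^esub> fst u, k \<odot>\<^bsub>M\<^esub> snd u)"
  "u \<otimes>\<^bsub>square_zero_ext A M\<^esub> v =
    (fst u \<otimes>\<^bsub>A\<^esub> fst v, lact M (fst u) (snd v) \<oplus>\<^bsub>M\<^esub> ract M (snd u) (fst v))"
  by (simp_all add: square_zero_ext_def dsum_def split_beta)

lemma beck_module_magmatic:
  assumes "beck_module K \<Omega> A M"
  shows "magmatic_algebra K (square_zero_ext A M)"
  using beck_module.square_zero_ext_in_variety[OF assms] by (simp add: in_variety_def)

text \<open>Over the empty set of equations, a Beck module is a module with two bilinear actions. Facts
  about square-zero extensions are applied to such modules before the equations are known to hold.\<close>

lemma beck_moduleI: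
  assumes "beck_module K ({} :: ('w, 'k) equation set) A M"
    and "\<And>E. E \<in> \<Omega> \<Longrightarrow> satisfies K (square_zero_ext A M) E"
  shows "beck_module K \<Omega> A M"
  using assms beck_module_magmatic[OF assms(1)]
  by (simp add: beck_module_def beck_module_axioms_def in_variety_def)

text \<open>The tensor algebra \<open>T = Tens2 K A\<close> is the free Beck module on one generator for the variety
  of all algebras, with \<open>a\<close> acting by right multiplication by \<open>\<lambda>(a)\<close> and \<open>\<rho>(a)\<close>.
  The following are the morphisms from it to \<open>M\<close>.\<close>

definition tens_beck_hom ::
  "('k, 'r) ring_scheme \<Rightarrow> ('k, 'a) module \<Rightarrow> ('k, 'a, 'm) bimod
    \<Rightarrow> ((('a \<times> 'a) list \<Rightarrow> 'k) set \<Rightarrow> 'm) set" where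
  "tens_beck_hom K A M = {h \<in> lin_hom K (Tens2 K A) M.
     \<forall>t\<in>carrier (Tens2 K A). \<forall>a\<in>carrier A.
       h (t \<otimes>\<^bsub>Tens2 K A\<^esub> tens_lambda K A a) = lact M a (h t) \<and>
       h (t \<otimes>\<^bsub>Tens2 K A\<^esub> tens_rho K A a) = ract M (h t) a}"

lemma beck_module_act_lin_hom:
  assumes "beck_module K \<Omega> A M" "a \<in> carrier A"
  shows "lact M a \<in> lin_hom K M M" "(\<lambda>x. ract M x a) \<in> lin_hom K M M"
proof -
  interpret beck_module K \<Omega> A M by fact
  show "lact M a \<in> lin_hom K M M" "(\<lambda>x. ract M x a) \<in> lin_hom K M M"
    using assms(2) by (auto intro!: lin_homI lact_closed ract_closed lact_add ract_add
      lact_smult ract_smult)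
qed

text \<open>The chain rule behind the whole argument: in \<open>A \<oplus> M\<close>, the module component of \<open>\<omega>(a + m)\<close>
  is the sum over the variables \<open>x\<close> of \<open>m\<^sub>x\<close> acted on by the partial derivative of \<open>\<omega>\<close>
  at \<open>a\<close>. Here \<open>m\<^sub>x = H x 1\<close>, and \<open>H x t\<close> stands for the action of \<open>t\<close> on \<open>m\<^sub>x\<close>.\<close>

lemma eval_square_zero_ext:
  fixes M :: "('k, 'a, 'm) bimod" and S :: "'v set"
  assumes A: "magmatic_algebra K A" and M: "beck_module K \<Omega> A M"
    and S: "finite S" and a: "a \<in> S \<rightarrow> carrier A"
    and H: "\<And>x. x \<in> S \<Longrightarrow> H x \<in> tens_beck_hom K A M"
    and \<omega>: "\<omega> \<in> carrier (KMag K S)"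
  shows "eval_at K (square_zero_ext A M) (\<lambda>x. (a x, H x \<one>\<^bsub>Tens2 K A\<^esub>)) \<omega> =
    (eval_at K A a \<omega>, \<Oplus>\<^bsub>M\<^esub>x\<in>S. H x (tens_eval K A a (partial_deriv K S x \<omega>)))"
proof -
  let ?T = "Tens2 K A" and ?N = "KMag K S" and ?E = "square_zero_ext A M"
  let ?c = "\<lambda>x. (a x, H x \<one>\<^bsub>?T\<^esub>)"
  interpret A: magmatic_algebra K A by fact
  interpret M: beck_module K \<Omega> A M by fact
  interpret E: magmatic_algebra K ?E by (rule beck_module_magmatic[OF M])
  note cr = A.R.cring_axioms
  note N = KMag_module[OF cr, of S]
  interpret T: assoc_alg K ?T
    by (rule Tens_assoc_alg[OF dsum_module[OF A.module_axioms A.module_axioms]])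
  interpret TN: assoc_alg K "Tens2 K ?N" by (rule Tens_assoc_alg[OF dsum_module[OF N N]])
  note ev = tens_eval_hom[OF A a]
  note evD = unital_alg_homD[OF ev(1)]
  note evl = lin_homD[OF evD(1)]
  note lrN = lin_homD(1)[OF tens_lambda_rho_lin_hom(1)[OF N]]
    lin_homD(1)[OF tens_lambda_rho_lin_hom(2)[OF N]]
  note lrA = lin_homD(1)[OF tens_lambda_rho_lin_hom(1)[OF A.module_axioms]]
    lin_homD(1)[OF tens_lambda_rho_lin_hom(2)[OF A.module_axioms]]
  have Hl: "H x \<in> lin_hom K ?T M" if "x \<in> S" for x
    using H[OF that] by (simp add: tens_beck_hom_def)
  have Ha: "H x (t \<otimes>\<^bsub>?T\<^esub> tens_lambda K A b) = lact M b (H x t)"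
    "H x (t \<otimes>\<^bsub>?T\<^esub> tens_rho K A b) = ract M (H x t) b"
    if "x \<in> S" "t \<in> carrier ?T" "b \<in> carrier A" for x t b
    using H[OF that(1)] that(2,3) by (auto simp: tens_beck_hom_def)
  have c: "?c \<in> S \<rightarrow> carrier ?E"
    using a lin_homD(1)[OF Hl T.B.one_closed] by auto
  define d where "d x t = tens_eval K A a (mag_deriv K S x t)" for x t
  have dc: "d x t \<in> carrier ?T" if "t \<in> Mag S" for x t
    unfolding d_def by (rule evl(1)[OF mag_deriv_closed[OF cr that]])
  have Hd: "H x (d x t) \<in> carrier M" if "x \<in> S" "t \<in> Mag S" for x t
    by (rule lin_homD(1)[OF Hl[OF that(1)] dc[OF that(2)]])
  have dGen: "d x (Gen y) = (if y = x then \<one>\<^bsub>?T\<^esub> else \<zero>\<^bsub>?T\<^esub>)" for x y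
    unfolding d_def using evD(3) lin_hom_zero[OF evD(1) TN.module_axioms T.module_axioms] by simp
  have dProd: "d x (Prod s t) = d x s \<otimes>\<^bsub>?T\<^esub> tens_rho K A (mag_eval A a t)
      \<oplus>\<^bsub>?T\<^esub> d x t \<otimes>\<^bsub>?T\<^esub> tens_lambda K A (mag_eval A a s)"
    if s: "s \<in> Mag S" and t: "t \<in> Mag S" for x s t
  proof -
    note ds = mag_deriv_closed[OF cr s, of x] and dt = mag_deriv_closed[OF cr t, of x]
    note ls = lrN(1)[OF KMag_single_closed[OF cr s]] and rt = lrN(2)[OF KMag_single_closed[OF cr t]]
    show ?thesis
      unfolding d_def mag_deriv.simps evl(2)[OF TN.B.m_closed[OF ds rt] TN.B.m_closed[OF dt ls]]
        evD(4)[OF ds rt] evD(4)[OF dt ls] ev(2)[OF s] ev(3)[OF t] ..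
  qed
  have tree: "mag_eval ?E ?c t = (mag_eval A a t, \<Oplus>\<^bsub>M\<^esub>x\<in>S. H x (d x t))" if "t \<in> Mag S" for t
    using that
  proof (induction t)
    case (Gen y)
    then have y: "y \<in> S" by simp
    have "(\<Oplus>\<^bsub>M\<^esub>x\<in>S. H x (d x (Gen y))) = (\<Oplus>\<^bsub>M\<^esub>x\<in>S. if y = x then H x \<one>\<^bsub>?T\<^esub> else \<zero>\<^bsub>M\<^esub>)"
      using lin_homD(1)[OF Hl T.B.one_closed] lin_hom_zero[OF Hl T.module_axioms M.module_axioms]
      by (intro M.finsum_cong') (auto simp: dGen)
    also have "\<dots> = H y \<one>\<^bsub>?T\<^esub>"
      using lin_homD(1)[OF Hl T.B.one_closed] by (intro M.finsum_singleton[OF y S]) auto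
    finally show ?case by simp
  next
    case (Prod s t)
    then have s: "s \<in> Mag S" and t: "t \<in> Mag S" by simp_all
    note es = mag_eval_closed[OF A a s] and et = mag_eval_closed[OF A a t]
    have cl: "lact M (mag_eval A a s) (H x (d x t)) \<in> carrier M"
      "ract M (H x (d x s)) (mag_eval A a t) \<in> carrier M" if "x \<in> S" for x
      using M.lact_closed[OF es Hd[OF that t]] M.ract_closed[OF et Hd[OF that s]] .
    have "H x (d x (Prod s t)) =
        lact M (mag_eval A a s) (H x (d x t)) \<oplus>\<^bsub>M\<^esub> ract M (H x (d x s)) (mag_eval A a t)"
      if x: "x \<in> S" for x
      unfolding dProd[OF s t] Ha(1)[OF x dc[OF t] es, symmetric] Ha(2)[OF x dc[OF s] et, symmetric]
      using lin_homD(2)[OF Hl[OF x] T.B.m_closed[OF dc[OF s, of x] lrA(2)[OF et]]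
          T.B.m_closed[OF dc[OF t, of x] lrA(1)[OF es]]]
        lin_homD(1)[OF Hl[OF x]] T.B.m_closed[OF dc[OF s, of x] lrA(2)[OF et]]
          T.B.m_closed[OF dc[OF t, of x] lrA(1)[OF es]] M.M.a_comm
      by simp
    then have "(\<Oplus>\<^bsub>M\<^esub>x\<in>S. H x (d x (Prod s t))) = (\<Oplus>\<^bsub>M\<^esub>x\<in>S.
        lact M (mag_eval A a s) (H x (d x t)) \<oplus>\<^bsub>M\<^esub> ract M (H x (d x s)) (mag_eval A a t))"
      using cl by (intro M.finsum_cong') auto
    also have "\<dots> = (\<Oplus>\<^bsub>M\<^esub>x\<in>S. lact M (mag_eval A a s) (H x (d x t)))
        \<oplus>\<^bsub>M\<^esub> (\<Oplus>\<^bsub>M\<^esub>x\<in>S. ract M (H x (d x s)) (mag_eval A a t))"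
      using cl by (intro M.finsum_addf) auto
    also have "\<dots> = lact M (mag_eval A a s) (\<Oplus>\<^bsub>M\<^esub>x\<in>S. H x (d x t))
        \<oplus>\<^bsub>M\<^esub> ract M (\<Oplus>\<^bsub>M\<^esub>x\<in>S. H x (d x s)) (mag_eval A a t)"
      using lin_hom_finsum[OF beck_module_act_lin_hom(1)[OF M es] M.module_axioms M.module_axioms S,
          of "\<lambda>x. H x (d x t)"]
        lin_hom_finsum[OF beck_module_act_lin_hom(2)[OF M et] M.module_axioms M.module_axioms S,
          of "\<lambda>x. H x (d x s)"] Hd s t
      by simp
    finally show ?case using Prod.IH s t by simp
  qed
  let ?D = "\<lambda>\<omega>. \<Oplus>\<^bsub>M\<^esub>x\<in>S. H x (tens_eval K A a (partial_deriv K S x \<omega>))"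
  have D: "?D \<in> lin_hom K ?N M"
    by (rule lin_hom_pointwise_finsum[OF S M.module_axioms
          lin_hom_comp[OF lin_hom_comp[OF partial_deriv_lin(1)[OF cr] evD(1)] Hl]])
  note ea = eval_at_lin[OF A a] and ee = eval_at_lin[OF E.magmatic_algebra_axioms c]
  have g: "(\<lambda>\<omega>. (eval_at K A a \<omega>, ?D \<omega>)) \<in> lin_hom K ?N ?E"
    by (rule lin_homI) (simp_all add: lin_homD[OF ea(1)] lin_homD[OF D])
  show ?thesis
  proof (rule free_module_lin_eqI[OF cr KMag_fields E.module_axioms ee(1) g _ \<omega>])
    fix t assume t: "t \<in> Mag S"
    show "eval_at K ?E ?c (single K t) = (eval_at K A a (single K t), ?D (single K t))"
      unfolding ee(2)[OF t] ea(2)[OF t] partial_deriv_lin(2)[OF cr t] tree[OF t] d_def ..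
  qed
qed

section \<open>Morphisms of Beck modules\<close>

lemma beck_homD:
  assumes "f \<in> beck_hom K A M N"
  shows "x \<in> carrier M \<Longrightarrow> f x \<in> carrier N"
    and "x \<in> carrier M \<Longrightarrow> y \<in> carrier M \<Longrightarrow> f (x \<oplus>\<^bsub>M\<^esub> y) = f x \<oplus>\<^bsub>N\<^esub> f y"
    and "k \<in> carrier K \<Longrightarrow> x \<in> carrier M \<Longrightarrow> f (k \<odot>\<^bsub>M\<^esub> x) = k \<odot>\<^bsub>N\<^esub> f x"
    and "a \<in> carrier A \<Longrightarrow> x \<in> carrier M \<Longrightarrow> f (lact M a x) = lact N a (f x)"
    and "a \<in> carrier A \<Longrightarrow> x \<in> carrier M \<Longrightarrow> f (ract M x a) = ract N (f x) a"
    and "f \<in> lin_hom K M N"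
  using assms by (auto simp: beck_hom_def intro: lin_homI)

lemma beck_homI:
  assumes "\<And>x. x \<in> carrier M \<Longrightarrow> f x \<in> carrier N"
    and "\<And>x y. x \<in> carrier M \<Longrightarrow> y \<in> carrier M \<Longrightarrow>
      x \<oplus>\<^bsub>M\<^esub> y \<in> carrier M \<and> f (x \<oplus>\<^bsub>M\<^esub> y) = f x \<oplus>\<^bsub>N\<^esub> f y"
    and "\<And>k x. k \<in> carrier K \<Longrightarrow> x \<in> carrier M \<Longrightarrow>
      k \<odot>\<^bsub>M\<^esub> x \<in> carrier M \<and> f (k \<odot>\<^bsub>M\<^esub> x) = k \<odot>\<^bsub>N\<^esub> f x"
    and "\<And>a x. a \<in> carrier A \<Longrightarrow> x \<in> carrier M \<Longrightarrow>
      lact M a x \<in> carrier M \<and> f (lact M a x) = lact N a (f x)"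
    and "\<And>a x. a \<in> carrier A \<Longrightarrow> x \<in> carrier M \<Longrightarrow>
      ract M x a \<in> carrier M \<and> f (ract M x a) = ract N (f x) a"
  shows "(\<lambda>x\<in>carrier M. f x) \<in> beck_hom K A M N"
  using assms by (auto simp: beck_hom_def)

lemma beck_hom_eqI:
  assumes "f \<in> beck_hom K A M N" "g \<in> beck_hom K A M N"
    and "\<And>x. x \<in> carrier M \<Longrightarrow> f x = g x"
  shows "f = g"
  using assms unfolding beck_hom_def by (auto intro: PiE_ext)

lemma beck_hom_closed:
  fixes M :: "('k, 'a, 'm) bimod" and N :: "('k, 'a, 'n) bimod"
  assumes M: "beck_module K \<Omega> A M" and N: "beck_module K \<Omega> A N"
  shows "(\<lambda>x\<in>carrier M. \<zero>\<^bsub>N\<^esub>) \<in> beck_hom K A M N"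
    and "(\<lambda>x\<in>carrier M. x) \<in> beck_hom K A M M"
    and "f \<in> beck_hom K A M N \<Longrightarrow> g \<in> beck_hom K A M N \<Longrightarrow>
      (\<lambda>x\<in>carrier M. f x \<oplus>\<^bsub>N\<^esub> g x) \<in> beck_hom K A M N"
    and "k \<in> carrier K \<Longrightarrow> f \<in> beck_hom K A M N \<Longrightarrow>
      (\<lambda>x\<in>carrier M. k \<odot>\<^bsub>N\<^esub> f x) \<in> beck_hom K A M N"
    and "f \<in> beck_hom K A M N \<Longrightarrow> h \<in> beck_hom K A M M \<Longrightarrow>
      compose (carrier M) f h \<in> beck_hom K A M N"
proof -
  interpret M: beck_module K \<Omega> A M by fact
  interpret N: beck_module K \<Omega> A N by fact
  have z: "lact N a \<zero>\<^bsub>N\<^esub> = \<zero>\<^bsub>N\<^esub>" "ract N \<zero>\<^bsub>N\<^esub> a = \<zero>\<^bsub>N\<^esub>" if "a \<in> carrier A" for a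
    using lin_hom_zero[OF beck_module_act_lin_hom(1)[OF N that] N.module_axioms N.module_axioms]
      lin_hom_zero[OF beck_module_act_lin_hom(2)[OF N that] N.module_axioms N.module_axioms]
    by simp_all
  note Mc = M.M.a_closed M.smult_closed M.lact_closed M.ract_closed
  show "(\<lambda>x\<in>carrier M. \<zero>\<^bsub>N\<^esub>) \<in> beck_hom K A M N"
    by (rule beck_homI) (simp_all add: Mc z)
  show "(\<lambda>x\<in>carrier M. x) \<in> beck_hom K A M M"
    by (rule beck_homI) (simp_all add: Mc)
  show "(\<lambda>x\<in>carrier M. f x \<oplus>\<^bsub>N\<^esub> g x) \<in> beck_hom K A M N"
    if f: "f \<in> beck_hom K A M N" and g: "g \<in> beck_hom K A M N"
    by (rule beck_homI)
      (simp_all add: Mc beck_homD[OF f] beck_homD[OF g] N.smult_r_distr N.lact_add N.ract_add N.M.a_ac)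
  show "(\<lambda>x\<in>carrier M. k \<odot>\<^bsub>N\<^esub> f x) \<in> beck_hom K A M N"
    if k: "k \<in> carrier K" and f: "f \<in> beck_hom K A M N"
    by (rule beck_homI)
      (simp_all add: Mc k beck_homD[OF f] N.smult_r_distr N.lact_smult N.ract_smult
        N.smult_assoc1[symmetric] M.R.m_comm)
  show "compose (carrier M) f h \<in> beck_hom K A M N"
    if f: "f \<in> beck_hom K A M N" and h: "h \<in> beck_hom K A M M"
    unfolding compose_def
    by (rule beck_homI) (simp_all add: Mc beck_homD[OF f] beck_homD[OF h])
qed

lemma beck_End_sel:
  "carrier (beck_End K A M) = beck_hom K A M M"
  "\<zero>\<^bsub>beck_End K A M\<^esub> = (\<lambda>x\<in>carrier M. \<zero>\<^bsub>M\<^esub>)"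
  "\<one>\<^bsub>beck_End K A M\<^esub> = (\<lambda>x\<in>carrier M. x)"
  "f \<oplus>\<^bsub>beck_End K A M\<^esub> g = (\<lambda>x\<in>carrier M. f x \<oplus>\<^bsub>M\<^esub> g x)"
  "k \<odot>\<^bsub>beck_End K A M\<^esub> f = (\<lambda>x\<in>carrier M. k \<odot>\<^bsub>M\<^esub> f x)"
  "f \<otimes>\<^bsub>beck_End K A M\<^esub> g = compose (carrier M) f g"
  by (simp_all add: beck_End_def)

lemma beck_End_assoc_alg:
  assumes M: "beck_module K \<Omega> A M"
  shows "assoc_alg K (beck_End K A M)"
proof -
  let ?E = "beck_End K A M"
  interpret M: beck_module K \<Omega> A M by fact
  have cl: "\<zero>\<^bsub>?E\<^esub> \<in> carrier ?E" "\<one>\<^bsub>?E\<^esub> \<in> carrier ?E"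
    "\<And>f g. f \<in> carrier ?E \<Longrightarrow> g \<in> carrier ?E \<Longrightarrow> f \<oplus>\<^bsub>?E\<^esub> g \<in> carrier ?E"
    "\<And>k f. k \<in> carrier K \<Longrightarrow> f \<in> carrier ?E \<Longrightarrow> k \<odot>\<^bsub>?E\<^esub> f \<in> carrier ?E"
    "\<And>f g. f \<in> carrier ?E \<Longrightarrow> g \<in> carrier ?E \<Longrightarrow> f \<otimes>\<^bsub>?E\<^esub> g \<in> carrier ?E"
    unfolding beck_End_sel by (fact beck_hom_closed[OF M M])+
  have app: "\<zero>\<^bsub>?E\<^esub> x = \<zero>\<^bsub>M\<^esub>" "\<one>\<^bsub>?E\<^esub> x = x" "(f \<oplus>\<^bsub>?E\<^esub> g) x = f x \<oplus>\<^bsub>M\<^esub> g x"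
    "(k \<odot>\<^bsub>?E\<^esub> f) x = k \<odot>\<^bsub>M\<^esub> f x" "(f \<otimes>\<^bsub>?E\<^esub> g) x = f (g x)"
    if "x \<in> carrier M" for x f g k
    using that by (simp_all add: beck_End_sel compose_def)
  have eqI: "f = g" if "f \<in> carrier ?E" "g \<in> carrier ?E" "\<And>x. x \<in> carrier M \<Longrightarrow> f x = g x" for f g
    using beck_hom_eqI[of f K A M M g] that by (simp add: beck_End_sel)
  have D: "f x \<in> carrier M" "f (x \<oplus>\<^bsub>M\<^esub> y) = f x \<oplus>\<^bsub>M\<^esub> f y"
    "k \<in> carrier K \<Longrightarrow> f (k \<odot>\<^bsub>M\<^esub> x) = k \<odot>\<^bsub>M\<^esub> f x"
    if "f \<in> carrier ?E" "x \<in> carrier M" "y \<in> carrier M" for f x y k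
    using beck_homD(1-3)[of f K A M M] that by (simp_all add: beck_End_sel)
  have ag: "abelian_group ?E"
  proof (rule abelian_groupI)
    fix f assume f: "f \<in> carrier ?E"
    have "((\<ominus>\<^bsub>K\<^esub> \<one>\<^bsub>K\<^esub>) \<odot>\<^bsub>?E\<^esub> f) \<oplus>\<^bsub>?E\<^esub> f = \<zero>\<^bsub>?E\<^esub>"
      by (rule eqI) (simp_all add: cl f app D[OF f] M.smult_l_minus M.M.l_neg)
    then show "\<exists>g\<in>carrier ?E. g \<oplus>\<^bsub>?E\<^esub> f = \<zero>\<^bsub>?E\<^esub>"
      using cl(4)[OF _ f, of "\<ominus>\<^bsub>K\<^esub> \<one>\<^bsub>K\<^esub>"] by auto
  qed (auto intro!: cl eqI simp: app D M.M.a_ac)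
  show ?thesis
  proof (rule assoc_algI)
    show "module K ?E"
      by (rule moduleI[OF M.R.cring_axioms ag])
        (auto intro!: cl eqI simp: app D M.smult_l_distr M.smult_r_distr M.smult_assoc1)
    show "ring ?E"
    proof (rule ringI[OF ag])
      show "monoid ?E"
        by (rule monoidI) (auto intro!: cl eqI simp: app D)
    qed (auto intro!: cl eqI simp: app D)
  qed (auto intro!: cl eqI simp: app D)
qed

section \<open>Beck modules from associative algebras\<close>

text \<open>Two linear maps \<open>l\<close>, \<open>r\<close> from \<open>A\<close> to an associative algebra \<open>B\<close> let \<open>A\<close> act on \<open>B\<close> by right
  multiplication by \<open>l a\<close> and \<open>r a\<close>. No compatibility between \<open>l\<close>, \<open>r\<close> and the product of \<open>A\<close> is
  needed: a Beck module for the variety of all algebras is a module with two bilinear actions.\<close>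

definition mult_bimod ::
  "('k, 'b, 's) module_scheme \<Rightarrow> ('a \<Rightarrow> 'b) \<Rightarrow> ('a \<Rightarrow> 'b) \<Rightarrow> ('k, 'a, 'b) bimod" where
  "mult_bimod B l r = \<lparr>carrier = carrier B, mult = mult B, one = one B, zero = zero B, add = add B,
     smult = smult B, lact = (\<lambda>a x. x \<otimes>\<^bsub>B\<^esub> l a), ract = (\<lambda>x a. x \<otimes>\<^bsub>B\<^esub> r a)\<rparr>"

lemma mult_bimod_sel [simp]:
  "carrier (mult_bimod B l r) = carrier B" "zero (mult_bimod B l r) = zero B"
  "add (mult_bimod B l r) = add B" "smult (mult_bimod B l r) = smult B"
  "lact (mult_bimod B l r) a x = x \<otimes>\<^bsub>B\<^esub> l a" "ract (mult_bimod B l r) x a = x \<otimes>\<^bsub>B\<^esub> r a"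
  by (simp_all add: mult_bimod_def)

lemma mult_bimod_beck_module:
  fixes A :: "('k, 'a) module" and B :: "('k, 'b, 's) module_scheme"
  assumes A: "magmatic_algebra K A" and B: "assoc_alg K B"
    and l: "l \<in> lin_hom K A B" and r: "r \<in> lin_hom K A B"
  shows "beck_module K ({} :: ('v, 'k) equation set) A (mult_bimod B l r)"
proof -
  let ?M = "mult_bimod B l r"
  interpret A: magmatic_algebra K A by fact
  interpret B: assoc_alg K B by fact
  note lD = lin_homD[OF l] and rD = lin_homD[OF r]
  have M: "module K ?M"
    by (rule module_cong[OF B.module_axioms]) simp_all
  have E: "module K (square_zero_ext A ?M)"
    by (rule module_cong[OF dsum_module[OF A.module_axioms M]]) (simp_all add: square_zero_ext_def)
  note simps = lD rD B.B.l_distr B.B.r_distr B.smult_mult_l B.smult_mult_r B.smult_r_distr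
  have "magmatic_algebra K (square_zero_ext A ?M)"
    unfolding magmatic_algebra_def magmatic_algebra_axioms_def
    using E by (auto simp: A.prod_closed A.prod_l_distr A.prod_r_distr A.prod_smult_l A.prod_smult_r
        simps B.M.a_ac)
  then show ?thesis
    unfolding beck_module_def beck_module_axioms_def in_variety_empty
    using M by (auto simp: simps)
qed

text \<open>The uniqueness half of the freeness of \<open>Tens2 K A\<close> on the generator \<open>1\<close>.\<close>

lemma tens_beck_hom_eqI:
  assumes A: "module K A" and M: "beck_module K \<Omega> A M"
    and g: "g \<in> tens_beck_hom K A M" and h: "h \<in> tens_beck_hom K A M"
    and one: "g \<one>\<^bsub>Tens2 K A\<^esub> = h \<one>\<^bsub>Tens2 K A\<^esub>" and t: "t \<in> carrier (Tens2 K A)"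
  shows "g t = h t"
proof -
  interpret M: beck_module K \<Omega> A M by fact
  interpret T: assoc_alg K "Tens2 K A" by (rule Tens_assoc_alg[OF dsum_module[OF A A]])
  have gl: "g \<in> lin_hom K (Tens2 K A) M" and hl: "h \<in> lin_hom K (Tens2 K A) M"
    using g h by (simp_all add: tens_beck_hom_def)
  note z = lin_hom_zero[OF gl T.module_axioms M.module_axioms]
    lin_hom_zero[OF hl T.module_axioms M.module_axioms]
  from A t show ?thesis
  proof (induction rule: tens2_induct)
    case (lambda t a)
    then show ?case using g h by (simp add: tens_beck_hom_def)
  next
    case (rho t a)
    then show ?case using g h by (simp add: tens_beck_hom_def)
  qed (simp_all add: one z lin_homD(2,3)[OF gl] lin_homD(2,3)[OF hl])
qed

text \<open>The quotient of \<open>Tens2 K A\<close> by an ideal, as a module over \<open>A\<close>.\<close>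

definition quot_bimod ::
  "('k, 'r) ring_scheme \<Rightarrow> ('k, 'a) module \<Rightarrow> (('a \<times> 'a) list \<Rightarrow> 'k) set set
    \<Rightarrow> ('k, 'a, (('a \<times> 'a) list \<Rightarrow> 'k) set set) bimod" where
  "quot_bimod K A I = mult_bimod (alg_quot (Tens2 K A) I)
     (\<lambda>a. I +>\<^bsub>Tens2 K A\<^esub> tens_lambda K A a) (\<lambda>a. I +>\<^bsub>Tens2 K A\<^esub> tens_rho K A a)"

text \<open>The actions are bilinear, and for each element \<open>X\<close> of the quotient the map sending \<open>t\<close> to \<open>X\<close>
  times the class of \<open>t\<close> is a morphism out of \<open>Tens2 K A\<close>.\<close>

lemma quot_bimod_magmatic:
  fixes A :: "('k, 'a) module"
  assumes A: "magmatic_algebra K A" and I: "ideal I (Tens2 K A)"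
  shows "beck_module K ({} :: ('v, 'k) equation set) A (quot_bimod K A I)"
    and "X \<in> carrier (quot_bimod K A I) \<Longrightarrow>
      (\<lambda>t. X \<otimes>\<^bsub>alg_quot (Tens2 K A) I\<^esub> (I +>\<^bsub>Tens2 K A\<^esub> t)) \<in> tens_beck_hom K A (quot_bimod K A I)"
proof -
  let ?T = "Tens2 K A" and ?Q = "alg_quot (Tens2 K A) I"
  interpret A: magmatic_algebra K A by fact
  note T = Tens_assoc_alg[OF dsum_module[OF A.module_axioms A.module_axioms]]
  interpret I: alg_ideal K ?T I using T I by (simp add: alg_ideal_def)
  interpret Q: assoc_alg K ?Q by (rule I.quot_assoc_alg)
  note co = unital_alg_homD(1)[OF I.coset_unital_alg_hom]
  note lr = tens_lambda_rho_lin_hom[OF A.module_axioms]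
  show "beck_module K ({} :: ('v, 'k) equation set) A (quot_bimod K A I)"
    unfolding quot_bimod_def
    by (rule mult_bimod_beck_module[OF A I.quot_assoc_alg lin_hom_comp[OF lr(1) co]
          lin_hom_comp[OF lr(2) co]])
  show "(\<lambda>t. X \<otimes>\<^bsub>?Q\<^esub> (I +>\<^bsub>?T\<^esub> t)) \<in> tens_beck_hom K A (quot_bimod K A I)"
    if "X \<in> carrier (quot_bimod K A I)"
  proof -
    have X: "X \<in> carrier ?Q" using that by (simp add: quot_bimod_def)
    have "(\<lambda>t. X \<otimes>\<^bsub>?Q\<^esub> (I +>\<^bsub>?T\<^esub> t)) \<in> lin_hom K ?T (quot_bimod K A I)"
      using lin_hom_comp[OF co assoc_alg_lin_homs(2)[OF I.quot_assoc_alg X]]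
      by (simp add: quot_bimod_def lin_hom_def)
    moreover have "X \<otimes>\<^bsub>?Q\<^esub> (I +>\<^bsub>?T\<^esub> (t \<otimes>\<^bsub>?T\<^esub> s)) = X \<otimes>\<^bsub>?Q\<^esub> (I +>\<^bsub>?T\<^esub> t) \<otimes>\<^bsub>?Q\<^esub> (I +>\<^bsub>?T\<^esub> s)"
      if "t \<in> carrier ?T" "s \<in> carrier ?T" for t s
      unfolding I.quot_sel(4)[OF that, symmetric]
      using Q.B.m_assoc[OF X I.coset_closed[OF that(1)] I.coset_closed[OF that(2)]] by simp
    ultimately show ?thesis
      using lin_homD(1)[OF lr(1)] lin_homD(1)[OF lr(2)]
      by (simp add: tens_beck_hom_def quot_bimod_def)
  qed
qed

text \<open>By the chain rule, the quotient is a Beck module over \<open>A\<close> as soon as the ideal contains the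
  partial derivatives of the equations.\<close>

lemma quot_bimod_beck_module:
  fixes A :: "('k, 'a) module"
  assumes A: "in_variety K \<Omega> A" and \<Omega>: "\<Omega> \<subseteq> equations K" and I: "ideal I (Tens2 K A)"
    and der: "\<And>S \<omega> x a. (S, \<omega>) \<in> \<Omega> \<Longrightarrow> x \<in> S \<Longrightarrow> a \<in> S \<rightarrow> carrier A \<Longrightarrow>
      tens_eval K A a (partial_deriv K S x \<omega>) \<in> I"
  shows "beck_module K \<Omega> A (quot_bimod K A I)"
proof (rule beck_moduleI)
  let ?T = "Tens2 K A" and ?Q = "alg_quot (Tens2 K A) I" and ?M = "quot_bimod K A I"
  let ?E = "square_zero_ext A ?M"
  have mA: "magmatic_algebra K A" using A by (simp add: in_variety_def)
  interpret A: magmatic_algebra K A by fact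
  note T = Tens_assoc_alg[OF dsum_module[OF A.module_axioms A.module_axioms]]
  interpret I: alg_ideal K ?T I using T I by (simp add: alg_ideal_def)
  interpret Q: assoc_alg K ?Q by (rule I.quot_assoc_alg)
  note M0 = quot_bimod_magmatic(1)[OF mA I]
  show "beck_module K ({} :: ('w, 'k) equation set) A ?M"
    by (rule M0)
  interpret M: beck_module K "{} :: ('w, 'k) equation set" A ?M by (rule M0)
  fix E assume E\<Omega>: "E \<in> \<Omega>"
  obtain S \<omega> where E: "E = (S, \<omega>)" by fastforce
  have S: "finite S" and \<omega>: "\<omega> \<in> carrier (KMag K S)"
    using E\<Omega> \<Omega> by (auto simp: E equations_def)
  have "eval_at K ?E c \<omega> = \<zero>\<^bsub>?E\<^esub>" if c: "c \<in> S \<rightarrow> carrier ?E" for c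
  proof -
    define a where "a x = fst (c x)" for x
    define H where "H x t = snd (c x) \<otimes>\<^bsub>?Q\<^esub> (I +>\<^bsub>?T\<^esub> t)" for x t
    have a: "a \<in> S \<rightarrow> carrier A" and m: "\<And>x. x \<in> S \<Longrightarrow> snd (c x) \<in> carrier ?M"
      using c by (auto simp: a_def Pi_iff mem_Times_iff)
    have mQ: "snd (c x) \<in> carrier ?Q" if "x \<in> S" for x
      using m[OF that] by (simp add: quot_bimod_def)
    have H: "H x \<in> tens_beck_hom K A ?M" if "x \<in> S" for x
      using quot_bimod_magmatic(2)[OF mA I m[OF that]] by (simp add: H_def[abs_def])
    have "eval_at K ?E c \<omega> = eval_at K ?E (\<lambda>x. (a x, H x \<one>\<^bsub>?T\<^esub>)) \<omega>"
      by (rule eval_at_cong[OF beck_module_magmatic[OF M0] c _ \<omega>])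
        (use mQ in \<open>simp add: a_def H_def I.quot_sel(2)[symmetric]\<close>)
    also have "\<dots> = (eval_at K A a \<omega>, \<Oplus>\<^bsub>?M\<^esub>x\<in>S. H x (tens_eval K A a (partial_deriv K S x \<omega>)))"
      by (rule eval_square_zero_ext[OF mA M0 S a H \<omega>])
    also have "eval_at K A a \<omega> = \<zero>\<^bsub>A\<^esub>"
      using A E\<Omega> a by (auto simp: in_variety_def satisfies_def E)
    also have "(\<Oplus>\<^bsub>?M\<^esub>x\<in>S. H x (tens_eval K A a (partial_deriv K S x \<omega>))) = (\<Oplus>\<^bsub>?M\<^esub>x\<in>S. \<zero>\<^bsub>?M\<^esub>)"
    proof (rule M.M.finsum_cong')
      fix x assume x: "x \<in> S"
      have "I +>\<^bsub>?T\<^esub> tens_eval K A a (partial_deriv K S x \<omega>) = \<zero>\<^bsub>?Q\<^esub>"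
        using I.J.a_rcos_const[OF der[OF E\<Omega>[unfolded E] x a]] by (simp add: I.quot_sel(1))
      then show "H x (tens_eval K A a (partial_deriv K S x \<omega>)) = \<zero>\<^bsub>?M\<^esub>"
        using mQ[OF x] by (simp add: H_def quot_bimod_def)
    qed auto
    also have "\<dots> = \<zero>\<^bsub>?M\<^esub>"
      by (rule M.M.finsum_zero)
    finally show ?thesis by simp
  qed
  then show "satisfies K ?E E"
    by (simp add: satisfies_def E)
qed

section \<open>The canonical map\<close>

lemma env_act_eq:
  assumes FAK: "is_FAK TYPE('m) K \<Omega> A F e"
    and M: "beck_module K \<Omega> A (M :: ('k, 'a, 'm) bimod)"
    and f: "f \<in> beck_hom K A F M"
  shows "env_act K A F e M (f e) \<phi> = f (\<phi> e)"
proof -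
  have e: "e \<in> carrier F" using FAK by (simp add: is_FAK_def)
  have "\<exists>!g. g \<in> beck_hom K A F M \<and> g e = f e"
    using FAK M beck_homD(1)[OF f e] by (simp add: is_FAK_def)
  then have "(THE g. g \<in> beck_hom K A F M \<and> g e = f e) = f"
    using f by (simp add: the1_equality)
  then show ?thesis
    using e by (simp add: env_act_def compose_def)
qed

text \<open>\<open>F\<close> is a free Beck module on one generator \<open>e\<close>, where freeness is tested only against Beck
  modules carried by the type of \<open>F\<close> itself. This suffices to construct the canonical map; its kernel
  and image need freeness with respect to a quotient of \<open>Tens2 K A\<close> as well.\<close>

locale free_beck_module =
  fixes K :: "('k, 'r) ring_scheme" and \<Omega> :: "('v, 'k) equation set" and A :: "('k, 'a) module"
    and F :: "('k, 'a, 'u) bimod" and e :: 'u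
  assumes A: "in_variety K \<Omega> A"
    and FAK: "is_FAK TYPE('u) K \<Omega> A F e"
begin

abbreviation "T \<equiv> Tens2 K A"
abbreviation "E \<equiv> beck_End K A F"

lemma A_magmatic: "magmatic_algebra K A"
  using A by (simp add: in_variety_def)

lemma A_module: "module K A"
  using A_magmatic by (rule magmatic_algebra.axioms(1))

lemma F_beck: "beck_module K \<Omega> A F" and e_closed: "e \<in> carrier F"
  using FAK by (simp_all add: is_FAK_def)

sublocale T: assoc_alg K T
  by (rule Tens_assoc_alg[OF dsum_module[OF A_module A_module]])

sublocale F: beck_module K \<Omega> A F
  by (rule F_beck)

sublocale E: assoc_alg K E
  by (rule beck_End_assoc_alg[OF F_beck])

lemma End_closed: "\<phi> \<in> carrier E \<Longrightarrow> x \<in> carrier F \<Longrightarrow> \<phi> x \<in> carrier F"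
  by (simp add: beck_End_sel beck_homD(1))

text \<open>Endomorphisms of \<open>F\<close> are determined by their value at the generator.\<close>

lemma End_eqI:
  assumes "\<phi> \<in> carrier E" "\<psi> \<in> carrier E" "\<phi> e = \<psi> e"
  shows "\<phi> = \<psi>"
proof -
  have "\<exists>!f. f \<in> beck_hom K A F F \<and> f e = \<phi> e"
    using FAK F_beck End_closed[OF assms(1) e_closed] by (simp add: is_FAK_def)
  then show ?thesis using assms by (auto simp: beck_End_sel)
qed

text \<open>The endomorphism of \<open>F\<close> that sends \<open>e\<close> to \<open>x\<close>.\<close>

definition end_of :: "'u \<Rightarrow> 'u \<Rightarrow> 'u" where
  "end_of x = (THE f. f \<in> beck_hom K A F F \<and> f e = x)"

lemma end_of:
  assumes "x \<in> carrier F"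
  shows "end_of x \<in> carrier E" "end_of x e = x"
proof -
  have "\<exists>!f. f \<in> beck_hom K A F F \<and> f e = x"
    using FAK F_beck assms by (simp add: is_FAK_def)
  from theI'[OF this] show "end_of x \<in> carrier E" "end_of x e = x"
    by (simp_all add: end_of_def beck_End_sel)
qed

lemma end_of_lin: "end_of \<in> lin_hom K F E"
proof (rule lin_homI)
  fix x assume x: "x \<in> carrier F"
  show "end_of x \<in> carrier E" by (rule end_of(1)[OF x])
next
  fix x y assume x: "x \<in> carrier F" and y: "y \<in> carrier F"
  show "end_of (x \<oplus>\<^bsub>F\<^esub> y) = end_of x \<oplus>\<^bsub>E\<^esub> end_of y"
  proof (rule End_eqI)
    show "end_of (x \<oplus>\<^bsub>F\<^esub> y) \<in> carrier E" by (rule end_of(1)[OF F.M.a_closed[OF x y]])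
    show "end_of x \<oplus>\<^bsub>E\<^esub> end_of y \<in> carrier E"
      by (rule E.M.a_closed[OF end_of(1)[OF x] end_of(1)[OF y]])
    show "end_of (x \<oplus>\<^bsub>F\<^esub> y) e = (end_of x \<oplus>\<^bsub>E\<^esub> end_of y) e"
      using e_closed by (simp add: end_of(2) x y F.M.a_closed beck_End_sel)
  qed
next
  fix k x assume k: "k \<in> carrier K" and x: "x \<in> carrier F"
  show "end_of (k \<odot>\<^bsub>F\<^esub> x) = k \<odot>\<^bsub>E\<^esub> end_of x"
  proof (rule End_eqI)
    show "end_of (k \<odot>\<^bsub>F\<^esub> x) \<in> carrier E" by (rule end_of(1)[OF F.smult_closed[OF k x]])
    show "k \<odot>\<^bsub>E\<^esub> end_of x \<in> carrier E" by (rule E.smult_closed[OF k end_of(1)[OF x]])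
    show "end_of (k \<odot>\<^bsub>F\<^esub> x) e = (k \<odot>\<^bsub>E\<^esub> end_of x) e"
      using e_closed by (simp add: end_of(2) k x F.smult_closed beck_End_sel)
  qed
qed

text \<open>The condition on all Beck modules \<open>M\<close> and all \<open>x\<close> in \<open>M\<close> reduces to \<open>M = F\<close> and \<open>x = e\<close>, because
  the morphism \<open>F \<rightarrow> M\<close> with \<open>e \<mapsto> x\<close> commutes with both actions.\<close>

lemma canonical_map_iff:
  "is_canonical_map TYPE('u) K \<Omega> A F e \<pi> \<longleftrightarrow>
    \<pi> \<in> extensional (carrier T) \<and> \<pi> \<in> unital_alg_hom K T E \<and>
    (\<forall>a\<in>carrier A. \<pi> (tens_lambda K A a) e = lact F a e \<and> \<pi> (tens_rho K A a) e = ract F e a)"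
    (is "?C \<longleftrightarrow> ?R")
proof
  assume C: ?C
  have id: "(\<lambda>x\<in>carrier F. x) \<in> beck_hom K A F F" "(\<lambda>x\<in>carrier F. x) e = e"
    using beck_hom_closed(2)[OF F_beck F_beck] e_closed by simp_all
  have \<pi>: "\<pi> \<in> unital_alg_hom K T E"
    using C by (simp add: is_canonical_map_def)
  have cl: "\<pi> t e \<in> carrier F" if "t \<in> carrier T" for t
    by (rule End_closed[OF lin_homD(1)[OF unital_alg_homD(1)[OF \<pi>] that] e_closed])
  have act: "env_act K A F e F e (\<pi> t) = \<pi> t e" if "t \<in> carrier T" for t
    using env_act_eq[OF FAK F_beck id(1), unfolded id(2), of "\<pi> t"] cl[OF that] by simp
  have "env_act K A F e F e (\<pi> (tens_lambda K A a)) = lact F a e \<and>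
      env_act K A F e F e (\<pi> (tens_rho K A a)) = ract F e a" if "a \<in> carrier A" for a
    using C F_beck e_closed that unfolding is_canonical_map_def by blast
  then show ?R
    using C act lin_homD(1)[OF tens_lambda_rho_lin_hom(1)[OF A_module]]
      lin_homD(1)[OF tens_lambda_rho_lin_hom(2)[OF A_module]]
    by (simp add: is_canonical_map_def)
next
  assume R: ?R
  have "env_act K A F e M x (\<pi> (tens_lambda K A a)) = lact M a x \<and>
      env_act K A F e M x (\<pi> (tens_rho K A a)) = ract M x a"
    if M: "beck_module K \<Omega> A M" and x: "x \<in> carrier M" and a: "a \<in> carrier A"
    for M :: "('k, 'a, 'u) bimod" and x a
  proof -
    have "\<exists>!f. f \<in> beck_hom K A F M \<and> f e = x"
      using FAK M x by (simp add: is_FAK_def)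
    then obtain f where f: "f \<in> beck_hom K A F M" "f e = x" by blast
    show ?thesis
      using env_act_eq[OF FAK M f(1), unfolded f(2)] R a beck_homD(4,5)[OF f(1) a e_closed] f(2)
      by simp
  qed
  with R show ?C by (simp add: is_canonical_map_def)
qed

theorem canonical_map_unique_exists: "\<exists>!\<pi>. is_canonical_map TYPE('u) K \<Omega> A F e \<pi>"
proof (rule ex_ex1I)
  define l where "l v = end_of (lact F (fst v) e \<oplus>\<^bsub>F\<^esub> ract F e (snd v))" for v
  interpret A: module K A by (rule A_module)
  have "(\<lambda>v. lact F (fst v) e \<oplus>\<^bsub>F\<^esub> ract F e (snd v)) \<in> lin_hom K (dsum A A) F"
    by (rule lin_homI)
      (auto simp: e_closed F.lact_closed F.ract_closed F.lact_add_alg F.ract_add_alg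
        F.lact_smult_alg F.ract_smult_alg F.smult_r_distr F.M.a_ac)
  from lin_hom_comp[OF this end_of_lin]
  have l: "l \<in> lin_hom K (dsum A A) E" by (simp add: l_def[abs_def])
  note L = tens_lift[OF dsum_module[OF A_module A_module] E.assoc_alg_axioms l]
  note lr = lin_homD(1)[OF tens_lambda_rho_lin_hom(1)[OF A_module]]
    lin_homD(1)[OF tens_lambda_rho_lin_hom(2)[OF A_module]]
  have z: "lact F \<zero>\<^bsub>A\<^esub> e = \<zero>\<^bsub>F\<^esub>" "ract F e \<zero>\<^bsub>A\<^esub> = \<zero>\<^bsub>F\<^esub>"
  proof -
    have l: "(\<lambda>a. lact F a e) \<in> lin_hom K A F" and r: "ract F e \<in> lin_hom K A F"
      by (auto intro!: lin_homI simp: e_closed F.lact_closed F.ract_closed F.lact_add_alg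
          F.ract_add_alg F.lact_smult_alg F.ract_smult_alg)
    show "lact F \<zero>\<^bsub>A\<^esub> e = \<zero>\<^bsub>F\<^esub>" "ract F e \<zero>\<^bsub>A\<^esub> = \<zero>\<^bsub>F\<^esub>"
      using lin_hom_zero[OF l A_module F.module_axioms] lin_hom_zero[OF r A_module F.module_axioms]
      by simp_all
  qed
  have gen: "tens_lift K E l (tens_lambda K A a) e = lact F a e"
    "tens_lift K E l (tens_rho K A a) e = ract F e a" if "a \<in> carrier A" for a
    using L(2)[of "(a, \<zero>\<^bsub>A\<^esub>)"] L(2)[of "(\<zero>\<^bsub>A\<^esub>, a)"] that z end_of(2)[OF F.lact_closed[OF that e_closed]]
      end_of(2)[OF F.ract_closed[OF that e_closed]] F.lact_closed[OF that e_closed]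
      F.ract_closed[OF that e_closed]
    by (simp_all add: tens_lambda_def tens_rho_def l_def)
  have "restrict (tens_lift K E l) (carrier T) \<in> unital_alg_hom K T E"
    using L(1) by (auto simp: unital_alg_hom_def ring_hom_def)
  then show "\<exists>\<pi>. is_canonical_map TYPE('u) K \<Omega> A F e \<pi>"
    using gen lr unfolding canonical_map_iff by (intro exI[of _ "restrict (tens_lift K E l) (carrier T)"]) simp
next
  fix \<pi> \<pi>' assume p: "is_canonical_map TYPE('u) K \<Omega> A F e \<pi>" "is_canonical_map TYPE('u) K \<Omega> A F e \<pi>'"
  note p1 = p(1)[unfolded canonical_map_iff] and p2 = p(2)[unfolded canonical_map_iff]
  have h: "\<pi> \<in> unital_alg_hom K T E" "\<pi>' \<in> unital_alg_hom K T E" using p1 p2 by simp_all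
  note lr = lin_homD(1)[OF tens_lambda_rho_lin_hom(1)[OF A_module]]
    lin_homD(1)[OF tens_lambda_rho_lin_hom(2)[OF A_module]]
  note hc = lin_homD(1)[OF unital_alg_homD(1)[OF h(1)]] lin_homD(1)[OF unital_alg_homD(1)[OF h(2)]]
  show "\<pi> = \<pi>'"
  proof (rule extensionalityI[of _ "carrier T"])
    show "\<pi> \<in> extensional (carrier T)" "\<pi>' \<in> extensional (carrier T)" using p1 p2 by simp_all
    show "\<pi> t = \<pi>' t" if "t \<in> carrier T" for t
      by (rule tens2_hom_eqI[OF A_module E.module_axioms h _ _ that];
          rule End_eqI) (use p1 p2 hc lr in simp_all)
  qed
qed

context
  fixes \<pi>
  assumes canonical: "is_canonical_map TYPE('u) K \<Omega> A F e \<pi>"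
begin

lemma canonical_hom: "\<pi> \<in> unital_alg_hom K T E"
  using canonical by (simp add: canonical_map_iff)

lemma canonical_End: "t \<in> carrier T \<Longrightarrow> \<pi> t \<in> carrier E"
  by (rule lin_homD(1)[OF unital_alg_homD(1)[OF canonical_hom]])

text \<open>The orbit map of \<open>e\<close> is a morphism of modules over \<open>A\<close> from \<open>T\<close> to \<open>F\<close>.\<close>

lemma canonical_tens_beck_hom: "(\<lambda>t. \<pi> t e) \<in> tens_beck_hom K A F"
proof -
  note \<pi>D = unital_alg_homD[OF canonical_hom]
  note lr = lin_homD(1)[OF tens_lambda_rho_lin_hom(1)[OF A_module]]
    lin_homD(1)[OF tens_lambda_rho_lin_hom(2)[OF A_module]]
  have lin: "(\<lambda>t. \<pi> t e) \<in> lin_hom K T F"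
    by (rule lin_homI)
      (simp_all add: End_closed canonical_End e_closed lin_homD[OF \<pi>D(1)] beck_End_sel(4,5))
  have "\<pi> (t \<otimes>\<^bsub>T\<^esub> tens_lambda K A a) e = lact F a (\<pi> t e) \<and>
      \<pi> (t \<otimes>\<^bsub>T\<^esub> tens_rho K A a) e = ract F (\<pi> t e) a"
    if t: "t \<in> carrier T" and a: "a \<in> carrier A" for t a
  proof -
    have h: "\<pi> t \<in> beck_hom K A F F" using canonical_End[OF t] by (simp add: beck_End_sel)
    show ?thesis
      using canonical[unfolded canonical_map_iff] a e_closed beck_homD(4,5)[OF h a e_closed]
      by (simp add: \<pi>D(4) t lr a beck_End_sel compose_def)
  qed
  with lin show ?thesis by (simp add: tens_beck_hom_def)
qed

lemma canonical_kernel_iff: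
  assumes "t \<in> carrier T"
  shows "t \<in> a_kernel T E \<pi> \<longleftrightarrow> \<pi> t e = \<zero>\<^bsub>F\<^esub>"
proof -
  have "\<pi> t = \<zero>\<^bsub>E\<^esub> \<longleftrightarrow> \<pi> t e = \<zero>\<^bsub>E\<^esub> e"
    using End_eqI[OF canonical_End[OF assms] E.M.zero_closed] by auto
  then show ?thesis
    using assms e_closed by (simp add: a_kernel_def' beck_End_sel)
qed

text \<open>Since the equation \<open>\<omega>\<close> holds in \<open>A \<oplus> F\<close>, its derivatives annihilate \<open>e\<close>, and an endomorphism
  that kills the generator is zero.\<close>

lemma derivative_in_kernel:
  assumes \<Omega>: "\<Omega> \<subseteq> equations K" and E\<Omega>: "(S, \<omega>) \<in> \<Omega>" and x: "x \<in> S" and a: "a \<in> S \<rightarrow> carrier A"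
  shows "tens_eval K A a (partial_deriv K S x \<omega>) \<in> a_kernel T E \<pi>"
proof -
  have S: "finite S" and \<omega>: "\<omega> \<in> carrier (KMag K S)"
    using E\<Omega> \<Omega> by (auto simp: equations_def)
  \<comment> \<open>At the point of \<open>A \<oplus> F\<close> over \<open>a\<close> with module component \<open>e\<close> at \<open>x\<close> and \<open>0\<close> elsewhere, the chain rule
    leaves the single summand for \<open>x\<close>.\<close>
  define H where "H y = (if x = y then (\<lambda>t. \<pi> t e) else (\<lambda>t. \<zero>\<^bsub>F\<^esub>))" for y
  have z: "(\<lambda>t. \<zero>\<^bsub>F\<^esub>) \<in> tens_beck_hom K A F"
    using lin_hom_zero[OF beck_module_act_lin_hom(1)[OF F_beck] F.module_axioms F.module_axioms]
      lin_hom_zero[OF beck_module_act_lin_hom(2)[OF F_beck] F.module_axioms F.module_axioms]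
    by (auto simp: tens_beck_hom_def intro!: lin_homI)
  have H: "H y \<in> tens_beck_hom K A F" for y
    using z canonical_tens_beck_hom by (simp add: H_def)
  have Hc: "H y t \<in> carrier F" if "t \<in> carrier T" for y t
    using H[of y] that by (auto simp: tens_beck_hom_def dest: lin_homD(1))
  let ?E = "square_zero_ext A F" and ?c = "\<lambda>y. (a y, H y \<one>\<^bsub>T\<^esub>)"
  let ?d = "\<lambda>y. tens_eval K A a (partial_deriv K S y \<omega>)"
  have d: "?d y \<in> carrier T" for y
    by (rule lin_homD(1)[OF unital_alg_homD(1)[OF tens_eval_hom(1)[OF A_magmatic a]]
          lin_homD(1)[OF partial_deriv_lin(1)[OF T.R.cring_axioms] \<omega>]])
  have "?c \<in> S \<rightarrow> carrier ?E"
    using a Hc[OF T.B.one_closed] by auto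
  then have "eval_at K ?E ?c \<omega> = \<zero>\<^bsub>?E\<^esub>"
    using F.square_zero_ext_in_variety E\<Omega> unfolding in_variety_def satisfies_def by blast
  then have "(\<Oplus>\<^bsub>F\<^esub>y\<in>S. H y (?d y)) = \<zero>\<^bsub>F\<^esub>"
    unfolding eval_square_zero_ext[OF A_magmatic F_beck S a H \<omega>] by simp
  moreover have "(\<Oplus>\<^bsub>F\<^esub>y\<in>S. H y (?d y)) = (\<Oplus>\<^bsub>F\<^esub>y\<in>S. if x = y then \<pi> (?d y) e else \<zero>\<^bsub>F\<^esub>)"
    using canonical_End[OF d] End_closed e_closed by (intro F.M.finsum_cong') (auto simp: H_def)
  moreover have "\<dots> = \<pi> (?d x) e"
    using canonical_End[OF d] End_closed e_closed by (intro F.M.finsum_singleton[OF x S]) auto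
  ultimately show ?thesis
    using canonical_kernel_iff[OF d] by simp
qed

end

text \<open>The kernel and the image are read off from the morphism \<open>F \<rightarrow> T/I\<close> that sends \<open>e\<close> to the
  class of \<open>1\<close>, which exists because \<open>T/I\<close> is a Beck module. It is inverse to the map
  \<open>T/I \<rightarrow> F\<close> induced by the orbit map of \<open>e\<close>.\<close>

theorem canonical_map_image_kernel:
  assumes \<Omega>: "\<Omega> \<subseteq> equations K"
    and FAK_quot: "is_FAK TYPE((('a \<times> 'a) list \<Rightarrow> 'k) set set) K \<Omega> A F e"
    and canonical: "is_canonical_map TYPE('u) K \<Omega> A F e \<pi>"
  shows "\<pi> ` carrier T = carrier E" and "a_kernel T E \<pi> = deriv_ideal K \<Omega> A"
proof -
  define I where "I = deriv_ideal K \<Omega> A"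
  let ?D = "{tens_eval K A a (partial_deriv K S x \<omega>) | S \<omega> x a.
        (S, \<omega>) \<in> \<Omega> \<and> x \<in> S \<and> a \<in> S \<rightarrow> carrier A}"
  let ?Q = "quot_bimod K A I"
  note hom = canonical_hom[OF canonical] and End = canonical_End[OF canonical]
  note ker = canonical_kernel_iff[OF canonical]
  have I_def': "I = genideal T ?D" by (simp add: I_def deriv_ideal_def)
  have DK: "?D \<subseteq> a_kernel T E \<pi>"
    using derivative_in_kernel[OF canonical \<Omega>] by blast
  have DT: "?D \<subseteq> carrier T"
    using DK unfolding a_kernel_def' by blast
  have I: "ideal I T" unfolding I_def' by (rule T.B.genideal_ideal[OF DT])
  have I_ker: "I \<subseteq> a_kernel T E \<pi>" unfolding I_def'
    by (rule T.B.genideal_minimal[OF unital_alg_hom_kernel[OF T.assoc_alg_axioms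
            E.assoc_alg_axioms hom] DK])
  interpret I: alg_ideal K T I using T.assoc_alg_axioms I by (simp add: alg_ideal_def)
  have DI: "d \<in> I" if "d \<in> ?D" for d
    using T.B.genideal_self[OF DT] that unfolding I_def' by (rule subsetD)
  have Q: "beck_module K \<Omega> A ?Q"
    by (rule quot_bimod_beck_module[OF A \<Omega> I DI]) blast
  interpret Q: beck_module K \<Omega> A ?Q by (rule Q)
  have one: "I +>\<^bsub>T\<^esub> \<one>\<^bsub>T\<^esub> \<in> carrier ?Q"
    using I.coset_closed[OF T.B.one_closed] by (simp add: quot_bimod_def)
  have "\<exists>!g. g \<in> beck_hom K A F ?Q \<and> g e = I +>\<^bsub>T\<^esub> \<one>\<^bsub>T\<^esub>"
    using FAK_quot Q one by (simp add: is_FAK_def)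
  then obtain g where g: "g \<in> beck_hom K A F ?Q" and ge: "g e = I +>\<^bsub>T\<^esub> \<one>\<^bsub>T\<^esub>" by blast
  have coset_hom: "(\<lambda>t. I +>\<^bsub>T\<^esub> t) \<in> tens_beck_hom K A ?Q"
  proof -
    note co = unital_alg_homD[OF I.coset_unital_alg_hom]
    note lr = lin_homD(1)[OF tens_lambda_rho_lin_hom(1)[OF A_module]]
      lin_homD(1)[OF tens_lambda_rho_lin_hom(2)[OF A_module]]
    show ?thesis
      using co(1) co(4) lr by (simp add: tens_beck_hom_def quot_bimod_def lin_hom_def)
  qed
  have orbit: "(\<lambda>t. \<pi> t e) \<in> tens_beck_hom K A F"
    by (rule canonical_tens_beck_hom[OF canonical])
  have orbit_lin: "(\<lambda>t. \<pi> t e) \<in> lin_hom K T F" using orbit by (simp add: tens_beck_hom_def)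
  have orbit_act: "\<pi> (t \<otimes>\<^bsub>T\<^esub> tens_lambda K A a) e = lact F a (\<pi> t e)"
    "\<pi> (t \<otimes>\<^bsub>T\<^esub> tens_rho K A a) e = ract F (\<pi> t e) a"
    if "t \<in> carrier T" "a \<in> carrier A" for t a
    using orbit that by (auto simp: tens_beck_hom_def)
  have orbit_one: "\<pi> \<one>\<^bsub>T\<^esub> e = e"
    using unital_alg_homD(3)[OF hom] e_closed by (simp add: beck_End_sel)
  have comp_hom: "(\<lambda>t. g (\<pi> t e)) \<in> tens_beck_hom K A ?Q"
    using lin_hom_comp[OF orbit_lin beck_homD(6)[OF g]] orbit_act
      beck_homD(4,5)[OF g] lin_homD(1)[OF orbit_lin]
    by (simp add: tens_beck_hom_def)
  have g_orbit: "g (\<pi> t e) = I +>\<^bsub>T\<^esub> t" if "t \<in> carrier T" for t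
    by (rule tens_beck_hom_eqI[OF A_module Q comp_hom coset_hom _ that])
      (simp add: orbit_one ge)
  show "a_kernel T E \<pi> = deriv_ideal K \<Omega> A"
    unfolding I_def[symmetric]
  proof (rule antisym[OF subsetI I_ker])
    fix t assume t: "t \<in> a_kernel T E \<pi>"
    then have tT: "t \<in> carrier T" by (simp add: a_kernel_def')
    have "I +>\<^bsub>T\<^esub> t = g \<zero>\<^bsub>F\<^esub>"
      using g_orbit[OF tT] ker[OF tT] t by simp
    also have "\<dots> = I"
      using lin_hom_zero[OF beck_homD(6)[OF g] F.module_axioms Q.module_axioms]
      by (simp add: quot_bimod_def I.quot_sel(1))
    finally show "t \<in> I"
      using I.J.rcos_const_imp_mem[OF tT] by simp
  qed
  \<comment> \<open>The composite \<open>F \<rightarrow> T/I \<rightarrow> F\<close> fixes \<open>e\<close>, so it is the identity and the orbit map is onto.\<close>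
  have \<pi>_coset: "\<pi> s e = \<pi> t e" if s: "s \<in> carrier T" and t: "t \<in> carrier T"
    and eq: "I +>\<^bsub>T\<^esub> s = I +>\<^bsub>T\<^esub> t" for s t
  proof -
    have "s \<in> I +>\<^bsub>T\<^esub> t" using I.J.a_rcos_self[OF s] eq by simp
    then obtain j where j: "j \<in> I" "s = j \<oplus>\<^bsub>T\<^esub> t"
      by (auto simp: a_r_coset_def r_coset_def)
    have jT: "j \<in> carrier T" using j I.J.a_subset by auto
    have "\<pi> j e = \<zero>\<^bsub>F\<^esub>" using I_ker j ker[OF jT] by auto
    then show ?thesis
      using lin_homD(2)[OF orbit_lin jT t] lin_homD(1)[OF orbit_lin t] j(2) by simp
  qed
  have "\<exists>t. t \<in> carrier T \<and> I +>\<^bsub>T\<^esub> t = g y" if "y \<in> carrier F" for y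
    using beck_homD(1)[OF g that] by (auto simp: quot_bimod_def elim!: I.quot_carrierE)
  then obtain \<tau> where \<tau>: "\<And>y. y \<in> carrier F \<Longrightarrow> \<tau> y \<in> carrier T"
    "\<And>y. y \<in> carrier F \<Longrightarrow> I +>\<^bsub>T\<^esub> \<tau> y = g y" by metis
  have \<tau>_eq: "\<pi> (\<tau> y) e = \<pi> t e" if "y \<in> carrier F" "t \<in> carrier T" "g y = I +>\<^bsub>T\<^esub> t" for y t
    by (rule \<pi>_coset[OF \<tau>(1)[OF that(1)] that(2)]) (simp add: \<tau>(2) that)
  have coset_lin: "(\<lambda>t. I +>\<^bsub>T\<^esub> t) \<in> lin_hom K T ?Q" using coset_hom by (simp add: tens_beck_hom_def)
  have coset_act: "I +>\<^bsub>T\<^esub> (t \<otimes>\<^bsub>T\<^esub> tens_lambda K A a) = lact ?Q a (I +>\<^bsub>T\<^esub> t)"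
    "I +>\<^bsub>T\<^esub> (t \<otimes>\<^bsub>T\<^esub> tens_rho K A a) = ract ?Q (I +>\<^bsub>T\<^esub> t) a"
    if "t \<in> carrier T" "a \<in> carrier A" for t a
    using coset_hom that unfolding tens_beck_hom_def by auto
  note lr = lin_homD(1)[OF tens_lambda_rho_lin_hom(1)[OF A_module]]
    lin_homD(1)[OF tens_lambda_rho_lin_hom(2)[OF A_module]]
  have k: "(\<lambda>y\<in>carrier F. \<pi> (\<tau> y) e) \<in> beck_hom K A F F"
  proof (rule beck_homI)
    fix x y assume x: "x \<in> carrier F" and y: "y \<in> carrier F"
    have "g (x \<oplus>\<^bsub>F\<^esub> y) = I +>\<^bsub>T\<^esub> (\<tau> x \<oplus>\<^bsub>T\<^esub> \<tau> y)"
      using beck_homD(2)[OF g x y] lin_homD(2)[OF coset_lin \<tau>(1)[OF x] \<tau>(1)[OF y]] \<tau>(2) x y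
      by simp
    from \<tau>_eq[OF F.M.a_closed[OF x y] T.M.a_closed[OF \<tau>(1)[OF x] \<tau>(1)[OF y]] this]
    show "x \<oplus>\<^bsub>F\<^esub> y \<in> carrier F \<and> \<pi> (\<tau> (x \<oplus>\<^bsub>F\<^esub> y)) e = \<pi> (\<tau> x) e \<oplus>\<^bsub>F\<^esub> \<pi> (\<tau> y) e"
      using lin_homD(2)[OF orbit_lin \<tau>(1)[OF x] \<tau>(1)[OF y]] F.M.a_closed[OF x y] by simp
  next
    fix c y assume c: "c \<in> carrier K" and y: "y \<in> carrier F"
    have "g (c \<odot>\<^bsub>F\<^esub> y) = I +>\<^bsub>T\<^esub> (c \<odot>\<^bsub>T\<^esub> \<tau> y)"
      using beck_homD(3)[OF g c y] lin_homD(3)[OF coset_lin c \<tau>(1)[OF y]] \<tau>(2) y by simp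
    from \<tau>_eq[OF F.smult_closed[OF c y] T.smult_closed[OF c \<tau>(1)[OF y]] this]
    show "c \<odot>\<^bsub>F\<^esub> y \<in> carrier F \<and> \<pi> (\<tau> (c \<odot>\<^bsub>F\<^esub> y)) e = c \<odot>\<^bsub>F\<^esub> \<pi> (\<tau> y) e"
      using lin_homD(3)[OF orbit_lin c \<tau>(1)[OF y]] F.smult_closed[OF c y] by simp
  next
    fix a y assume a: "a \<in> carrier A" and y: "y \<in> carrier F"
    have "g (lact F a y) = I +>\<^bsub>T\<^esub> (\<tau> y \<otimes>\<^bsub>T\<^esub> tens_lambda K A a)"
      using beck_homD(4)[OF g a y] coset_act(1)[OF \<tau>(1)[OF y] a] \<tau>(2) y by simp
    from \<tau>_eq[OF F.lact_closed[OF a y] T.B.m_closed[OF \<tau>(1)[OF y] lr(1)[OF a]] this]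
    show "lact F a y \<in> carrier F \<and> \<pi> (\<tau> (lact F a y)) e = lact F a (\<pi> (\<tau> y) e)"
      using orbit_act(1)[OF \<tau>(1)[OF y] a] F.lact_closed[OF a y] by simp
    have "g (ract F y a) = I +>\<^bsub>T\<^esub> (\<tau> y \<otimes>\<^bsub>T\<^esub> tens_rho K A a)"
      using beck_homD(5)[OF g a y] coset_act(2)[OF \<tau>(1)[OF y] a] \<tau>(2) y by simp
    from \<tau>_eq[OF F.ract_closed[OF a y] T.B.m_closed[OF \<tau>(1)[OF y] lr(2)[OF a]] this]
    show "ract F y a \<in> carrier F \<and> \<pi> (\<tau> (ract F y a)) e = ract F (\<pi> (\<tau> y) e) a"
      using orbit_act(2)[OF \<tau>(1)[OF y] a] F.ract_closed[OF a y] by simp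
  qed (rule lin_homD(1)[OF orbit_lin \<tau>(1)])
  have "(\<lambda>y\<in>carrier F. \<pi> (\<tau> y) e) = \<one>\<^bsub>E\<^esub>"
  proof (rule End_eqI)
    show "(\<lambda>y\<in>carrier F. \<pi> (\<tau> y) e) e = \<one>\<^bsub>E\<^esub> e"
      using \<tau>_eq[OF e_closed T.B.one_closed ge] orbit_one e_closed by (simp add: beck_End_sel)
    show "(\<lambda>y\<in>carrier F. \<pi> (\<tau> y) e) \<in> carrier E" using k by (simp only: beck_End_sel(1))
  qed (rule E.B.one_closed)
  then have \<tau>_id: "\<pi> (\<tau> y) e = y" if "y \<in> carrier F" for y
    using that by (metis beck_End_sel(3) restrict_apply')
  have "\<phi> \<in> \<pi> ` carrier T" if \<phi>: "\<phi> \<in> carrier E" for \<phi>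
  proof -
    note y = End_closed[OF \<phi> e_closed]
    have "\<phi> = \<pi> (\<tau> (\<phi> e))"
      by (rule End_eqI[OF \<phi> End[OF \<tau>(1)[OF y]]]) (simp add: \<tau>_id[OF y])
    then show ?thesis using \<tau>(1)[OF y] by blast
  qed
  then show "\<pi> ` carrier T = carrier E"
    using End by blast
qed

end

theorem proposition4p3:
  fixes K :: "('k, 'r) ring_scheme"
    and \<Omega> :: "('v, 'k) equation set"
    and A :: "('k, 'a) module"
    and F :: "('k, 'a, 'u) bimod"
    and e :: 'u
  assumes "cring K"
    and "\<Omega> \<subseteq> equations K"
    and "in_variety K \<Omega> A"
    and "is_FAK TYPE('u) K \<Omega> A F e"
    and "is_FAK TYPE((('a \<times> 'a) list \<Rightarrow> 'k) set set) K \<Omega> A F e"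
  shows "(\<exists>!\<pi>. is_canonical_map TYPE('u) K \<Omega> A F e \<pi>) \<and>
    (\<forall>\<pi>. is_canonical_map TYPE('u) K \<Omega> A F e \<pi> \<longrightarrow>
       \<pi> ` carrier (Tens2 K A) = carrier (beck_End K A F) \<and>
       a_kernel (Tens2 K A) (beck_End K A F) \<pi> = deriv_ideal K \<Omega> A)"
proof -
  interpret free_beck_module K \<Omega> A F e
    by (rule free_beck_module.intro[OF assms(3,4)])
  show ?thesis
    using canonical_map_unique_exists canonical_map_image_kernel[OF assms(2,5)] by blast
qed

end
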